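(* Let $\mathcal{A}$ be an operator ideal, let $\lambda\geq 1$, and let $X$ be a real Banach space. The following statements are equivalent. (a) $\mathfrak{F}(X)$ has the Lip-$\mathcal{A}$-$\lambda$-BAP. (b) $\mathfrak{F}(X)$ has the $\mathcal{A}$-$\lambda$-BAP. (c) $\delta_X\in\overline{\mathrm{Lip}_{\mathcal{A}}^{\lambda}(X,\mathfrak{F}(X))}^{\tau_c}$. (d) $\mathrm{Id}_{\mathrm{Lip}_0(X)}\in\overline{\mathcal{A}_c^{\lambda}(\mathrm{Lip}_0(X),\mathrm{Lip}_0(X))}^{w^*}$, where $w^*$ is the weak-star topology on $\mathcal{L}(\mathrm{Lip}_0(X),\mathrm{Lip}_0(X))$ with respect to $\mathrm{Lip}_0(X)\widehat{\otimes}_\pi\mathfrak{F}(X)$. Furthermore, if one of (a)-(d) holds, then $X$ has the Lip-$\mathcal{A}$-$\lambda$-BAP.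
   Context: All Banach spaces are real. For Banach spaces $X,Y$, $\mathcal{L}(X,Y)$ is the space of bounded linear operators, and $\mathrm{Lip}_0(X,Y)$ is the Banach space of Lipschitz maps $f:X\to Y$ with $f(0)=0$, with norm $\|f\|_{\mathrm{Lip}}=\sup_{x\neq y}\|f(x)-f(y)\|/\|x-y\|$; $\mathrm{Lip}_0(X)=\mathrm{Lip}_0(X,\mathbb{R})$. For $x\in X$ let $\delta_x\in \mathrm{Lip}_0(X)^*$, $\delta_x(f)=f(x)$. The Lipschitz-free space is $\mathfrak{F}(X)=\overline{\mathrm{span}}\{\delta_x: x\in X\}\subseteq \mathrm{Lip}_0(X)^*$, and $\delta_X:X\to\mathfrak{F}(X)$, $\delta_X(x)=\delta_x$, is a (nonlinear) isometry. For each $f\in\mathrm{Lip}_0(X,Y)$ there is a unique $L_f\in\mathcal{L}(\mathfrak{F}(X),Y)$ with $L_f\delta_X=f$; $\|L_f\|=\|f\|_{\mathrm{Lip}}$, and $f\mapsto L_f$ is an isometric isomorphism of $\mathrm{Lip}_0(X,Y)$ onto $\mathcal{L}(\mathfrak{F}(X),Y)$. In particular $\mathrm{Lip}_0(X)$ is identified with $\mathfrak{F}(X)^*$. Operator ideals are (linear) operator ideals in the usual sense. For an operator ideal $\mathcal{A}$ and $\lambda\ge 1$: $\mathcal{A}^\lambda(X,Y)=\{T\in\mathcal{A}(X,Y):\|T\|\le\lambda\}$; $\mathrm{Lip}_{\mathcal{A}}(X,Y)=\{f\in\mathrm{Lip}_0(X,Y): L_f\in\mathcal{A}(\mathfrak{F}(X),Y)\}$;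 $\mathrm{Lip}_{\mathcal{A}}^\lambda(X,Y)=\{f\in\mathrm{Lip}_{\mathcal{A}}(X,Y):\|f\|_{\mathrm{Lip}}\le\lambda\}$; $\mathcal{A}_c^\lambda(Y^*,X^* )=\{T^*: T\in\mathcal{A}^\lambda(X,Y)\}$. Thus $\mathcal{A}_c^\lambda(\mathrm{Lip}_0(X),\mathrm{Lip}_0(X))=\{T^*:T\in\mathcal{A}^\lambda(\mathfrak{F}(X),\mathfrak{F}(X))\}$. $\tau_c$ denotes the compact-open topology (uniform convergence on compact subsets of the domain). A Banach space $Z$ has the $\mathcal{A}$-$\lambda$-BAP if $\mathrm{Id}_Z\in\overline{\mathcal{A}^\lambda(Z,Z)}^{\tau_c}$, and the Lip-$\mathcal{A}$-$\lambda$-BAP if $\mathrm{Id}_Z\in\overline{\mathrm{Lip}_{\mathcal{A}}^\lambda(Z,Z)}^{\tau_c}$. The weak-star topology on $\mathcal{L}(\mathrm{Lip}_0(X),\mathrm{Lip}_0(X))=\mathcal{L}(\mathrm{Lip}_0(X),\mathfrak{F}(X)^* )$ is the one coming from the identification with $(\mathrm{Lip}_0(X)\widehat{\otimes}_\pi\mathfrak{F}(X))^*$, where $\widehat{\otimes}_\pi$ is the projective tensor product and $\langle g\otimes\mu,T\rangle=\langle\mu,Tg\rangle$. *)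

theory Defs
  imports "HOL-Analysis.Analysis"
begin

section \<open>The space \<open>Lip\<^sub>0(X,Y)\<close>\<close>

typedef (overloaded) ('a::real_normed_vector, 'b::real_normed_vector) lip0 =
  "{f :: 'a \<Rightarrow> 'b. f 0 = 0 \<and> (\<exists>L. L-lipschitz_on UNIV f)}"
  morphisms lip_apply Abs_lip0
  by (rule exI[of _ "\<lambda>_. 0"]) (auto intro!: exI[of _ 0] lipschitz_onI)

setup_lifting type_definition_lip0

lemma lip0_eqI: "(\<And>x. lip_apply f x = lip_apply g x) \<Longrightarrow> f = g"
  by (simp add: lip_apply_inject[symmetric] fun_eq_iff)

lemma lip_apply_0 [simp]: "lip_apply f 0 = 0"
  using lip_apply[of f] by simp

lemma lip_apply_quotient_bdd:
  "bdd_above (range (\<lambda>(x, y). norm (lip_apply f x - lip_apply f y) / norm (x - y)))"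
proof -
  obtain L where L: "L-lipschitz_on UNIV (lip_apply f)"
    using lip_apply[of f] by auto
  have "norm (lip_apply f x - lip_apply f y) / norm (x - y) \<le> L" for x y
    using lipschitz_on_normD[OF L, of x y] lipschitz_on_nonneg[OF L]
    by (cases "x = y") (auto simp: divide_le_eq)
  then show ?thesis
    by (intro bdd_aboveI[of _ L]) auto
qed

instantiation lip0 :: (real_normed_vector, real_normed_vector) real_normed_vector
begin

text \<open>The diagonal pairs contribute \<open>0 / 0 = 0\<close> to the supremum.\<close>
definition norm_lip0 :: "('a, 'b) lip0 \<Rightarrow> real" where
  "norm f = (SUP (x, y). norm (lip_apply f x - lip_apply f y) / norm (x - y))"

lift_definition zero_lip0 :: "('a, 'b) lip0" is "\<lambda>_. 0"
  by (auto intro!: exI[of _ 0] lipschitz_onI)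

lift_definition plus_lip0 :: "('a, 'b) lip0 \<Rightarrow> ('a, 'b) lip0 \<Rightarrow> ('a, 'b) lip0"
  is "\<lambda>f g x. f x + g x"
  by (auto intro: lipschitz_on_add)

lift_definition minus_lip0 :: "('a, 'b) lip0 \<Rightarrow> ('a, 'b) lip0 \<Rightarrow> ('a, 'b) lip0"
  is "\<lambda>f g x. f x - g x"
  by (auto intro: lipschitz_on_diff)

lift_definition uminus_lip0 :: "('a, 'b) lip0 \<Rightarrow> ('a, 'b) lip0"
  is "\<lambda>f x. - f x"
  by (auto intro: lipschitz_on_minus)

lift_definition scaleR_lip0 :: "real \<Rightarrow> ('a, 'b) lip0 \<Rightarrow> ('a, 'b) lip0"
  is "\<lambda>c f x. c *\<^sub>R f x"
  by (auto intro: lipschitz_on_cmult)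

definition dist_lip0 :: "('a, 'b) lip0 \<Rightarrow> ('a, 'b) lip0 \<Rightarrow> real" where
  "dist_lip0 f g = norm (f - g)"

definition uniformity_lip0 :: "(('a, 'b) lip0 \<times> ('a, 'b) lip0) filter" where
  "uniformity_lip0 = (INF e\<in>{0 <..}. principal {(x, y). dist x y < e})"

definition open_lip0 :: "('a, 'b) lip0 set \<Rightarrow> bool" where
  "open_lip0 S = (\<forall>x\<in>S. \<forall>\<^sub>F (x', y) in uniformity. x' = x \<longrightarrow> y \<in> S)"

definition sgn_lip0 :: "('a, 'b) lip0 \<Rightarrow> ('a, 'b) lip0" where
  "sgn_lip0 f = scaleR (inverse (norm f)) f"

lemma lip_norm:
  fixes f :: "('a, 'b) lip0"
  shows "norm (lip_apply f x - lip_apply f y) \<le> norm f * norm (x - y)"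
proof (cases "x = y")
  case False
  have "norm (lip_apply f x - lip_apply f y) / norm (x - y) \<le> norm f"
    unfolding norm_lip0_def
    by (rule cSUP_upper2[OF lip_apply_quotient_bdd, of "(x, y)"]) auto
  with False show ?thesis by (simp add: divide_le_eq)
qed simp

lemma norm_lip0_le:
  fixes f :: "('a, 'b) lip0"
  assumes "\<And>x y. norm (lip_apply f x - lip_apply f y) \<le> L * norm (x - y)" and "0 \<le> L"
  shows "norm f \<le> L"
  unfolding norm_lip0_def
proof (rule cSUP_least, simp, clarify)
  fix x y
  show "norm (lip_apply f x - lip_apply f y) / norm (x - y) \<le> L"
    using assms by (cases "x = y") (auto simp: divide_le_eq)
qed

lemma norm_lip0_nonneg: "0 \<le> norm f" for f :: "('a, 'b) lip0"
  unfolding norm_lip0_def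
  by (rule cSUP_upper2[OF lip_apply_quotient_bdd, of "(0, 0)"]) auto

instance
proof
  fix f g :: "('a, 'b) lip0" and c d :: real
  show "dist f g = norm (f - g)" by (rule dist_lip0_def)
  show "uniformity = (INF e\<in>{0 <..}. principal {(x :: ('a, 'b) lip0, y). dist x y < e})"
    by (rule uniformity_lip0_def)
  show "open S = (\<forall>x\<in>S. \<forall>\<^sub>F (x', y) in uniformity. x' = x \<longrightarrow> y \<in> S)" for S :: "('a, 'b) lip0 set"
    by (rule open_lip0_def)
  show "sgn f = scaleR (inverse (norm f)) f" by (rule sgn_lip0_def)
  show "f + g + h = f + (g + h)" for h by transfer (simp add: algebra_simps)
  show "f + g = g + f" by transfer (simp add: algebra_simps)
  show "0 + f = f" by transfer simp
  show "- f + f = 0" by transfer simp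
  show "f - g = f + - g" by transfer simp
  show "c *\<^sub>R (f + g) = c *\<^sub>R f + c *\<^sub>R g" by transfer (simp add: algebra_simps)
  show "(c + d) *\<^sub>R f = c *\<^sub>R f + d *\<^sub>R f" by transfer (simp add: algebra_simps)
  show "c *\<^sub>R d *\<^sub>R f = (c * d) *\<^sub>R f" by transfer simp
  show "1 *\<^sub>R f = f" by transfer simp
  show "norm f = 0 \<longleftrightarrow> f = 0"
  proof
    assume "norm f = 0"
    then show "f = 0"
      using lip_norm[of f _ 0] by (intro lip0_eqI) (simp add: zero_lip0.rep_eq)
  next
    assume "f = 0"
    then show "norm f = 0"
      by (intro antisym norm_lip0_nonneg norm_lip0_le) (auto simp: zero_lip0.rep_eq)
  qed
  show "norm (f + g) \<le> norm f + norm g"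
  proof (rule norm_lip0_le)
    fix x y
    have "norm (lip_apply (f + g) x - lip_apply (f + g) y)
        \<le> norm (lip_apply f x - lip_apply f y) + norm (lip_apply g x - lip_apply g y)"
      by (simp add: plus_lip0.rep_eq norm_diff_triangle_ineq)
    also have "\<dots> \<le> (norm f + norm g) * norm (x - y)"
      using lip_norm[of f x y] lip_norm[of g x y] by (simp add: algebra_simps)
    finally show "norm (lip_apply (f + g) x - lip_apply (f + g) y)
        \<le> (norm f + norm g) * norm (x - y)" .
  qed (simp add: norm_lip0_nonneg)
  have le: "norm (c *\<^sub>R f) \<le> \<bar>c\<bar> * norm f" for c and f :: "('a, 'b) lip0"
  proof (rule norm_lip0_le)
    fix x y
    have "norm (lip_apply (c *\<^sub>R f) x - lip_apply (c *\<^sub>R f) y)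
        = \<bar>c\<bar> * norm (lip_apply f x - lip_apply f y)"
      by (simp add: scaleR_lip0.rep_eq scaleR_diff_right[symmetric])
    also have "\<dots> \<le> \<bar>c\<bar> * norm f * norm (x - y)"
      using mult_left_mono[OF lip_norm[of f x y], of "\<bar>c\<bar>"] by (simp add: algebra_simps)
    finally show "norm (lip_apply (c *\<^sub>R f) x - lip_apply (c *\<^sub>R f) y)
        \<le> \<bar>c\<bar> * norm f * norm (x - y)" .
  qed (simp add: norm_lip0_nonneg)
  show "norm (c *\<^sub>R f) = \<bar>c\<bar> * norm f"
  proof (cases "c = 0")
    case True
    then show ?thesis using le[of c f] norm_lip0_nonneg[of "c *\<^sub>R f"] by simp
  next
    case False
    have "inverse c *\<^sub>R c *\<^sub>R f = f"
      using False by (intro lip0_eqI) (simp add: scaleR_lip0.rep_eq)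
    then have "norm f \<le> \<bar>inverse c\<bar> * norm (c *\<^sub>R f)"
      using le[of "inverse c" "c *\<^sub>R f"] by simp
    then have "\<bar>c\<bar> * norm f \<le> norm (c *\<^sub>R f)"
      using False by (simp add: field_simps)
    with le[of c f] show ?thesis by simp
  qed
qed

end


section \<open>The Lipschitz-free space\<close>

lift_definition lip_eval :: "'a::real_normed_vector \<Rightarrow> ('a, real) lip0 \<Rightarrow>\<^sub>L real"
  is "\<lambda>x f. lip_apply f x"
proof -
  fix x :: 'a
  show "bounded_linear (\<lambda>f :: ('a, real) lip0. lip_apply f x)"
    using lip_norm[where 'b = real, of _ x 0]
    by (intro bounded_linear_intro[where K = "norm x"])
      (auto simp: plus_lip0.rep_eq scaleR_lip0.rep_eq)
qed

lemma subspace_closure: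
  fixes S :: "'a::real_normed_vector set"
  assumes "subspace S"
  shows "subspace (closure S)"
  unfolding subspace_def
proof (intro conjI ballI allI)
  show "0 \<in> closure S"
    using closure_subset[of S] subspace_0[OF assms] by blast
next
  fix x y assume "x \<in> closure S" "y \<in> closure S"
  then obtain u v where "\<And>n. u n \<in> S" "u \<longlonglongrightarrow> x" "\<And>n. v n \<in> S" "v \<longlonglongrightarrow> y"
    unfolding closure_sequential by blast
  then show "x + y \<in> closure S"
    unfolding closure_sequential
    by (intro exI[of _ "\<lambda>n. u n + v n"]) (auto intro: tendsto_add subspace_add[OF assms])
next
  fix c x assume "x \<in> closure S"
  then obtain u where "\<And>n. u n \<in> S" "u \<longlonglongrightarrow> x"
    unfolding closure_sequential by blast
  then show "c *\<^sub>R x \<in> closure S"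
    unfolding closure_sequential
    by (intro exI[of _ "\<lambda>n. c *\<^sub>R u n"])
      (auto intro: tendsto_scaleR subspace_scale[OF assms])
qed

typedef (overloaded) 'a::real_normed_vector free =
  "closure (span (range lip_eval)) :: (('a, real) lip0 \<Rightarrow>\<^sub>L real) set"
  by (rule exI[of _ 0]) (auto intro: subspace_0 subspace_closure)

setup_lifting type_definition_free

lemma subspace_free: "subspace (closure (span (range lip_eval)))"
  by (intro subspace_closure subspace_span)

instantiation free :: (real_normed_vector) real_normed_vector
begin

lift_definition norm_free :: "'a free \<Rightarrow> real" is norm .
lift_definition zero_free :: "'a free" is 0
  by (rule subspace_0[OF subspace_free])
lift_definition plus_free :: "'a free \<Rightarrow> 'a free \<Rightarrow> 'a free" is "(+)"
  by (rule subspace_add[OF subspace_free])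
lift_definition minus_free :: "'a free \<Rightarrow> 'a free \<Rightarrow> 'a free" is "(-)"
  by (rule subspace_diff[OF subspace_free])
lift_definition uminus_free :: "'a free \<Rightarrow> 'a free" is uminus
  by (rule subspace_neg[OF subspace_free])
lift_definition scaleR_free :: "real \<Rightarrow> 'a free \<Rightarrow> 'a free" is "(*\<^sub>R)"
  by (rule subspace_scale[OF subspace_free])

definition dist_free :: "'a free \<Rightarrow> 'a free \<Rightarrow> real" where
  "dist_free f g = norm (f - g)"

definition uniformity_free :: "('a free \<times> 'a free) filter" where
  "uniformity_free = (INF e\<in>{0 <..}. principal {(x, y). dist x y < e})"

definition open_free :: "'a free set \<Rightarrow> bool" where
  "open_free S = (\<forall>x\<in>S. \<forall>\<^sub>F (x', y) in uniformity. x' = x \<longrightarrow> y \<in> S)"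

definition sgn_free :: "'a free \<Rightarrow> 'a free" where
  "sgn_free f = scaleR (inverse (norm f)) f"

instance
  apply standard
  unfolding dist_free_def open_free_def sgn_free_def uniformity_free_def
  apply (rule refl | (transfer, force simp: algebra_simps norm_triangle_ineq))+
  done

end

instance free :: (real_normed_vector) banach
proof
  fix X :: "nat \<Rightarrow> 'a free"
  assume X: "Cauchy X"
  have D: "dist (Rep_free x) (Rep_free y) = dist x y" for x y :: "'a free"
    by (simp add: dist_norm norm_free.rep_eq minus_free.rep_eq)
  have "Cauchy (\<lambda>n. Rep_free (X n))"
    using X by (simp add: Cauchy_def D)
  then obtain l where l: "(\<lambda>n. Rep_free (X n)) \<longlonglongrightarrow> l"
    by (auto simp: Cauchy_convergent_iff convergent_def)
  have "l \<in> closure (span (range lip_eval))"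
    by (rule closed_sequentially[OF closed_closure Rep_free l])
  then obtain m where "l = Rep_free m"
    by (rule Rep_free_cases)
  with l have "X \<longlonglongrightarrow> m"
    by (simp add: tendsto_iff D)
  then show "convergent X" by (rule convergentI)
qed

lift_definition delta :: "'a::real_normed_vector \<Rightarrow> 'a free" is lip_eval
  by (intro subsetD[OF closure_subset] span_base) simp

text \<open>\<open>linearization f\<close> is the operator \<open>L\<^sub>f\<close>, the unique bounded linear operator with
  \<open>L\<^sub>f \<circ> \<delta>\<^sub>X = f\<close>; it exists whenever the codomain is complete.\<close>
definition linearization :: "('a::real_normed_vector, 'b::banach) lip0 \<Rightarrow> 'a free \<Rightarrow>\<^sub>L 'b" where
  "linearization f = (THE L. \<forall>x. blinfun_apply L (delta x) = lip_apply f x)"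

text \<open>The identification of \<open>Lip\<^sub>0(X)\<close> with the dual of the free space, \<open>\<langle>\<mu>, g\<rangle> = \<mu>(g)\<close>,
  and its inverse \<open>\<phi> \<mapsto> \<phi> \<circ> \<delta>\<^sub>X\<close>.\<close>

lift_definition free_pairing :: "('a::real_normed_vector, real) lip0 \<Rightarrow> 'a free \<Rightarrow>\<^sub>L real"
  is "\<lambda>g \<mu>. blinfun_apply (Rep_free \<mu>) g"
proof -
  fix g :: "('a, real) lip0"
  have "\<bar>blinfun_apply m g\<bar> \<le> norm m * norm g" for m :: "('a, real) lip0 \<Rightarrow>\<^sub>L real"
    using norm_blinfun[of m g] by simp
  then show "bounded_linear (\<lambda>\<mu>. blinfun_apply (Rep_free \<mu>) g)"
    by (intro bounded_linear_intro[where K = "norm g"])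
      (simp_all add: plus_free.rep_eq scaleR_free.rep_eq norm_free.rep_eq blinfun.bilinear_simps)
qed

lift_definition lip_to_dual :: "('a::real_normed_vector, real) lip0 \<Rightarrow>\<^sub>L ('a free \<Rightarrow>\<^sub>L real)"
  is free_pairing
proof (rule bounded_linear_intro[where K = 1])
  fix f g :: "('a, real) lip0" and c :: real
  show "free_pairing (f + g) = free_pairing f + free_pairing g"
    by (rule blinfun_eqI) (simp add: free_pairing.rep_eq blinfun.bilinear_simps)
  show "free_pairing (c *\<^sub>R f) = c *\<^sub>R free_pairing f"
    by (rule blinfun_eqI) (simp add: free_pairing.rep_eq blinfun.bilinear_simps)
  show "norm (free_pairing f) \<le> norm f * 1"
  proof (rule norm_blinfun_bound)
    fix \<mu>
    show "norm (blinfun_apply (free_pairing f) \<mu>) \<le> norm f * 1 * norm \<mu>"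
      using norm_blinfun[of "Rep_free \<mu>" f]
      by (simp add: free_pairing.rep_eq norm_free.rep_eq mult.commute)
  qed simp
qed

lemma norm_delta_diff_le: "norm (delta x - delta y) \<le> norm (x - y)"
  for x y :: "'a::real_normed_vector"
proof -
  have "norm (lip_eval x - lip_eval y) \<le> norm (x - y)"
  proof (rule norm_blinfun_bound)
    fix f :: "('a, real) lip0"
    show "norm (blinfun_apply (lip_eval x - lip_eval y) f) \<le> norm (x - y) * norm f"
      using lip_norm[of f x y] by (simp add: blinfun.diff_left lip_eval.rep_eq mult.commute)
  qed simp
  then show ?thesis
    by (simp add: norm_free.rep_eq minus_free.rep_eq delta.rep_eq)
qed

lemma delta_0: "delta (0 :: 'a::real_normed_vector) = 0"
proof -
  have "lip_eval 0 = (0 :: ('a, real) lip0 \<Rightarrow>\<^sub>L real)"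
    by (rule blinfun_eqI) (simp add: lip_eval.rep_eq)
  then show ?thesis
    by (simp add: Rep_free_inject[symmetric] delta.rep_eq zero_free.rep_eq)
qed

lift_definition dual_fun :: "('a::real_normed_vector free \<Rightarrow>\<^sub>L real) \<Rightarrow> ('a, real) lip0"
  is "\<lambda>\<phi> x. blinfun_apply \<phi> (delta x)"
proof (intro conjI exI lipschitz_onI)
  fix \<phi> :: "'a free \<Rightarrow>\<^sub>L real" and x y
  show "blinfun_apply \<phi> (delta 0) = 0" by (simp add: delta_0)
  have "dist (blinfun_apply \<phi> (delta x)) (blinfun_apply \<phi> (delta y))
      \<le> norm \<phi> * norm (delta x - delta y)"
    unfolding dist_norm blinfun.diff_right[symmetric] by (rule norm_blinfun)
  also have "\<dots> \<le> norm \<phi> * dist x y"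
    unfolding dist_norm by (intro mult_left_mono norm_delta_diff_le norm_ge_zero)
  finally show "dist (blinfun_apply \<phi> (delta x)) (blinfun_apply \<phi> (delta y)) \<le> norm \<phi> * dist x y" .
qed simp

lift_definition dual_to_lip :: "('a::real_normed_vector free \<Rightarrow>\<^sub>L real) \<Rightarrow>\<^sub>L ('a, real) lip0"
  is dual_fun
proof (rule bounded_linear_intro[where K = 1])
  fix \<phi> \<psi> :: "'a free \<Rightarrow>\<^sub>L real" and c :: real
  show "dual_fun (\<phi> + \<psi>) = dual_fun \<phi> + dual_fun \<psi>"
    by (rule lip0_eqI) (simp add: dual_fun.rep_eq plus_lip0.rep_eq blinfun.bilinear_simps)
  show "dual_fun (c *\<^sub>R \<phi>) = c *\<^sub>R dual_fun \<phi>"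
    by (rule lip0_eqI) (simp add: dual_fun.rep_eq scaleR_lip0.rep_eq blinfun.bilinear_simps)
  show "norm (dual_fun \<phi>) \<le> norm \<phi> * 1"
  proof (rule norm_lip0_le)
    fix x y
    have "norm (blinfun_apply \<phi> (delta x - delta y)) \<le> norm \<phi> * norm (delta x - delta y)"
      by (rule norm_blinfun)
    also have "\<dots> \<le> norm \<phi> * norm (x - y)"
      by (intro mult_left_mono norm_delta_diff_le norm_ge_zero)
    finally show "norm (lip_apply (dual_fun \<phi>) x - lip_apply (dual_fun \<phi>) y)
        \<le> norm \<phi> * 1 * norm (x - y)"
      by (simp add: dual_fun.rep_eq blinfun.bilinear_simps)
  qed simp
qed

lemma free_operator_eqI:
  fixes L M :: "'a::real_normed_vector free \<Rightarrow>\<^sub>L 'b::real_normed_vector"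
  assumes "\<And>x. blinfun_apply L (delta x) = blinfun_apply M (delta x)"
  shows "L = M"
proof (rule blinfun_eqI)
  fix \<mu> :: "'a free"
  have D: "dist (Rep_free x) (Rep_free y) = dist x y" for x y :: "'a free"
    by (simp add: dist_norm norm_free.rep_eq minus_free.rep_eq)
  have span: "\<exists>\<nu>. m = Rep_free \<nu> \<and> blinfun_apply L \<nu> = blinfun_apply M \<nu>"
    if "m \<in> span (range lip_eval)" for m :: "('a, real) lip0 \<Rightarrow>\<^sub>L real"
    using that
  proof (induction rule: span_induct_alt)
    case base
    show ?case by (rule exI[of _ 0]) (simp add: zero_free.rep_eq)
  next
    case (step c x y)
    from step(1) obtain z where "x = Rep_free (delta z)" by (auto simp: delta.rep_eq)
    moreover from step(2) obtain \<eta>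
      where "y = Rep_free \<eta>" "blinfun_apply L \<eta> = blinfun_apply M \<eta>" by blast
    ultimately show ?case
      using assms by (intro exI[of _ "c *\<^sub>R delta z + \<eta>"])
        (simp add: plus_free.rep_eq scaleR_free.rep_eq blinfun.bilinear_simps)
  qed
  obtain s where s: "\<And>n. s n \<in> span (range lip_eval)" "s \<longlonglongrightarrow> Rep_free \<mu>"
    using Rep_free[of \<mu>] unfolding closure_sequential by blast
  have "\<exists>\<nu>. s n = Rep_free \<nu> \<and> blinfun_apply L \<nu> = blinfun_apply M \<nu>" for n
    by (rule span) (rule s(1))
  then obtain t where t: "\<And>n. s n = Rep_free (t n)"
    and eq: "\<And>n. blinfun_apply L (t n) = blinfun_apply M (t n)" by metis
  have "t \<longlonglongrightarrow> \<mu>" using s(2) by (simp add: tendsto_iff D t)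
  then have "(\<lambda>n. blinfun_apply L (t n)) \<longlonglongrightarrow> blinfun_apply L \<mu>"
    "(\<lambda>n. blinfun_apply M (t n)) \<longlonglongrightarrow> blinfun_apply M \<mu>"
    by (auto intro: blinfun.tendsto tendsto_const)
  then show "blinfun_apply L \<mu> = blinfun_apply M \<mu>"
    unfolding eq by (rule LIMSEQ_unique)
qed

lemma linearization_eqI:
  assumes "\<And>x. blinfun_apply L (delta x) = lip_apply f x"
  shows "linearization f = L"
  unfolding linearization_def using assms by (intro the_equality) (auto intro: free_operator_eqI)

lemma dual_to_lip_to_dual: "blinfun_apply dual_to_lip (blinfun_apply lip_to_dual g) = g"
  by (rule lip0_eqI)
    (simp add: dual_to_lip.rep_eq lip_to_dual.rep_eq dual_fun.rep_eq free_pairing.rep_eq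
      delta.rep_eq lip_eval.rep_eq)

lemma lip_to_dual_to_lip: "blinfun_apply lip_to_dual (blinfun_apply dual_to_lip \<phi>) = \<phi>"
  by (rule free_operator_eqI)
    (simp add: dual_to_lip.rep_eq lip_to_dual.rep_eq dual_fun.rep_eq free_pairing.rep_eq
      delta.rep_eq lip_eval.rep_eq)

lemma linearization_real: "linearization g = blinfun_apply lip_to_dual g"
  by (rule linearization_eqI)
    (simp add: lip_to_dual.rep_eq free_pairing.rep_eq delta.rep_eq lip_eval.rep_eq)


section \<open>Adjoints\<close>

lift_definition adjoint_op ::
    "('a::real_normed_vector \<Rightarrow>\<^sub>L 'b::real_normed_vector) \<Rightarrow> ('b \<Rightarrow>\<^sub>L real) \<Rightarrow>\<^sub>L ('a \<Rightarrow>\<^sub>L real)"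
  is "\<lambda>T \<phi>. \<phi> o\<^sub>L T"
  by (rule bounded_bilinear.bounded_linear_left[OF bounded_bilinear_blinfun_compose])

text \<open>An operator on the dual of the free space, seen as an operator on \<open>Lip\<^sub>0(X)\<close>.\<close>
definition on_lip0 ::
    "(('a::real_normed_vector free \<Rightarrow>\<^sub>L real) \<Rightarrow>\<^sub>L ('a free \<Rightarrow>\<^sub>L real))
      \<Rightarrow> ('a, real) lip0 \<Rightarrow>\<^sub>L ('a, real) lip0" where
  "on_lip0 S = dual_to_lip o\<^sub>L S o\<^sub>L lip_to_dual"


section \<open>Operator ideals\<close>

text \<open>An operator ideal is a class of operators between arbitrary Banach spaces. As types cannot be
  quantified over, it is given here on all Banach spaces whose underlying set is a subset of a type
  \<open>'u\<close>, which plays the role of a universe. To speak about the operators between given Banach spaces,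
  \<open>'u\<close> must be large enough to contain copies of them.\<close>

record 'u bspace =
  bs_carrier :: "'u set"
  bs_add :: "'u \<Rightarrow> 'u \<Rightarrow> 'u"
  bs_zero :: 'u
  bs_scale :: "real \<Rightarrow> 'u \<Rightarrow> 'u"
  bs_norm :: "'u \<Rightarrow> real"

definition bs_dist :: "'u bspace \<Rightarrow> 'u \<Rightarrow> 'u \<Rightarrow> real" where
  "bs_dist V u v = bs_norm V (bs_add V u (bs_scale V (-1) v))"

definition banach_space_on :: "'u bspace \<Rightarrow> bool" where
  "banach_space_on V \<longleftrightarrow>
    bs_zero V \<in> bs_carrier V \<and>
    (\<forall>u\<in>bs_carrier V. \<forall>v\<in>bs_carrier V. bs_add V u v \<in> bs_carrier V) \<and>
    (\<forall>c. \<forall>u\<in>bs_carrier V. bs_scale V c u \<in> bs_carrier V) \<and>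
    (\<forall>u\<in>bs_carrier V. \<forall>v\<in>bs_carrier V. \<forall>w\<in>bs_carrier V.
      bs_add V (bs_add V u v) w = bs_add V u (bs_add V v w)) \<and>
    (\<forall>u\<in>bs_carrier V. \<forall>v\<in>bs_carrier V. bs_add V u v = bs_add V v u) \<and>
    (\<forall>u\<in>bs_carrier V. bs_add V (bs_zero V) u = u) \<and>
    (\<forall>u\<in>bs_carrier V. bs_add V u (bs_scale V (-1) u) = bs_zero V) \<and>
    (\<forall>c. \<forall>u\<in>bs_carrier V. \<forall>v\<in>bs_carrier V.
      bs_scale V c (bs_add V u v) = bs_add V (bs_scale V c u) (bs_scale V c v)) \<and>
    (\<forall>c d. \<forall>u\<in>bs_carrier V. bs_scale V (c + d) u = bs_add V (bs_scale V c u) (bs_scale V d u)) \<and>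
    (\<forall>c d. \<forall>u\<in>bs_carrier V. bs_scale V c (bs_scale V d u) = bs_scale V (c * d) u) \<and>
    (\<forall>u\<in>bs_carrier V. bs_scale V 1 u = u) \<and>
    (\<forall>u\<in>bs_carrier V. 0 \<le> bs_norm V u \<and> (bs_norm V u = 0 \<longleftrightarrow> u = bs_zero V)) \<and>
    (\<forall>u\<in>bs_carrier V. \<forall>v\<in>bs_carrier V. bs_norm V (bs_add V u v) \<le> bs_norm V u + bs_norm V v) \<and>
    (\<forall>c. \<forall>u\<in>bs_carrier V. bs_norm V (bs_scale V c u) = \<bar>c\<bar> * bs_norm V u) \<and>
    Metric_space.mcomplete (bs_carrier V) (bs_dist V)"

text \<open>Operators with domain \<open>V\<close> are represented by functions that are \<open>undefined\<close> outside the
  carrier of \<open>V\<close>.\<close>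
definition bounded_ops :: "'u bspace \<Rightarrow> 'u bspace \<Rightarrow> ('u \<Rightarrow> 'u) set" where
  "bounded_ops V W = {T \<in> bs_carrier V \<rightarrow>\<^sub>E bs_carrier W.
    (\<forall>u\<in>bs_carrier V. \<forall>v\<in>bs_carrier V. T (bs_add V u v) = bs_add W (T u) (T v)) \<and>
    (\<forall>c. \<forall>u\<in>bs_carrier V. T (bs_scale V c u) = bs_scale W c (T u)) \<and>
    (\<exists>K. \<forall>u\<in>bs_carrier V. bs_norm W (T u) \<le> K * bs_norm V u)}"

definition bounded_functionals :: "'u bspace \<Rightarrow> ('u \<Rightarrow> real) set" where
  "bounded_functionals V = {\<phi>.
    (\<forall>u\<in>bs_carrier V. \<forall>v\<in>bs_carrier V. \<phi> (bs_add V u v) = \<phi> u + \<phi> v) \<and>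
    (\<forall>c. \<forall>u\<in>bs_carrier V. \<phi> (bs_scale V c u) = c * \<phi> u) \<and>
    (\<exists>K. \<forall>u\<in>bs_carrier V. \<bar>\<phi> u\<bar> \<le> K * bs_norm V u)}"

text \<open>Each component \<open>A V W\<close> is a linear subspace of the bounded operators from \<open>V\<close> to \<open>W\<close> that
  contains the rank-one operators (hence all finite-rank ones), and \<open>A\<close> is stable under composition
  with bounded operators on both sides.\<close>
definition operator_ideal :: "('u bspace \<Rightarrow> 'u bspace \<Rightarrow> ('u \<Rightarrow> 'u) set) \<Rightarrow> bool" where
  "operator_ideal A \<longleftrightarrow>
    (\<forall>V W. banach_space_on V \<and> banach_space_on W \<longrightarrow>
      A V W \<subseteq> bounded_ops V W \<and>
      (\<forall>\<phi>\<in>bounded_functionals V. \<forall>w\<in>bs_carrier W.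
        (\<lambda>v\<in>bs_carrier V. bs_scale W (\<phi> v) w) \<in> A V W) \<and>
      (\<forall>S\<in>A V W. \<forall>T\<in>A V W. (\<lambda>v\<in>bs_carrier V. bs_add W (S v) (T v)) \<in> A V W) \<and>
      (\<forall>c. \<forall>T\<in>A V W. (\<lambda>v\<in>bs_carrier V. bs_scale W c (T v)) \<in> A V W)) \<and>
    (\<forall>V0 V W W0. banach_space_on V0 \<and> banach_space_on V \<and> banach_space_on W \<and> banach_space_on W0 \<longrightarrow>
      (\<forall>S\<in>bounded_ops V0 V. \<forall>T\<in>A V W. \<forall>R\<in>bounded_ops W W0.
        (\<lambda>v\<in>bs_carrier V0. R (T (S v))) \<in> A V0 W0))"

text \<open>The copy inside \<open>'u\<close> of a Banach space given as a type, along an injection \<open>i\<close>, and the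
  corresponding copy of an operator.\<close>

definition bspace_copy :: "('b::real_normed_vector \<Rightarrow> 'u) \<Rightarrow> 'u bspace" where
  "bspace_copy i =
    \<lparr>bs_carrier = range i,
     bs_add = (\<lambda>u v. i (inv i u + inv i v)),
     bs_zero = i 0,
     bs_scale = (\<lambda>c u. i (c *\<^sub>R inv i u)),
     bs_norm = (\<lambda>u. norm (inv i u))\<rparr>"

definition op_copy ::
    "('b::real_normed_vector \<Rightarrow> 'u) \<Rightarrow> ('c::real_normed_vector \<Rightarrow> 'u) \<Rightarrow> ('b \<Rightarrow>\<^sub>L 'c) \<Rightarrow> 'u \<Rightarrow> 'u" where
  "op_copy i j T = (\<lambda>u\<in>range i. j (blinfun_apply T (inv i u)))"

text \<open>The component \<open>A(Y,Z)\<close> for Banach spaces \<open>Y\<close> and \<open>Z\<close> given as types. The choice of the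
  injections is immaterial, see \<open>ideal_component_iff\<close> below.\<close>
definition ideal_component ::
    "('u bspace \<Rightarrow> 'u bspace \<Rightarrow> ('u \<Rightarrow> 'u) set) \<Rightarrow> ('b::banach \<Rightarrow>\<^sub>L 'c::banach) set" where
  "ideal_component A =
    {T. \<exists>(i :: 'b \<Rightarrow> 'u) (j :: 'c \<Rightarrow> 'u). inj i \<and> inj j \<and>
      op_copy i j T \<in> A (bspace_copy i) (bspace_copy j)}"

lemma banach_space_on_copy:
  fixes i :: "'b::banach \<Rightarrow> 'u"
  assumes i: "inj i"
  shows "banach_space_on (bspace_copy i)"
proof -
  have d: "bs_dist (bspace_copy i) u v = dist (inv i u) (inv i v)" for u v
    by (simp add: bs_dist_def bspace_copy_def i dist_norm)
  interpret M: Metric_space "range i" "bs_dist (bspace_copy i)"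
    by unfold_locales (auto simp: d dist_commute i dist_triangle inv_f_f)
  have "M.mcomplete"
    unfolding M.mcomplete_def
  proof (intro allI impI)
    fix s assume s: "M.MCauchy s"
    then have r: "range s \<subseteq> range i" by (simp add: M.MCauchy_def)
    have "Cauchy (\<lambda>n. inv i (s n))"
      using s by (auto simp: M.MCauchy_def d Cauchy_def)
    then obtain l where l: "(\<lambda>n. inv i (s n)) \<longlonglongrightarrow> l"
      by (auto simp: Cauchy_convergent_iff convergent_def)
    have "limitin M.mtopology s (i l) sequentially"
      unfolding M.limitin_metric
      using l r by (auto simp: d i tendsto_iff image_subset_iff)
    then show "\<exists>x. limitin M.mtopology s x sequentially" ..
  qed
  then have c: "Metric_space.mcomplete (bs_carrier (bspace_copy i)) (bs_dist (bspace_copy i))"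
    by (simp add: bspace_copy_def)
  show ?thesis
    unfolding banach_space_on_def
    using c by (simp add: bspace_copy_def i algebra_simps norm_triangle_ineq inj_eq[OF i])
qed

lemma op_copy_bounded:
  fixes i :: "'b::banach \<Rightarrow> 'u" and j :: "'c::banach \<Rightarrow> 'u"
  assumes "inj i" "inj j"
  shows "op_copy i j T \<in> bounded_ops (bspace_copy i) (bspace_copy j)"
proof -
  have "\<forall>u\<in>range i. norm (blinfun_apply T (inv i u)) \<le> norm T * norm (inv i u)"
    by (simp add: norm_blinfun)
  then show ?thesis
    unfolding bounded_ops_def op_copy_def bspace_copy_def
    using assms by (simp add: blinfun.bilinear_simps) blast
qed

lemma ideal_component_iff:
  fixes i :: "'b::banach \<Rightarrow> 'u" and j :: "'c::banach \<Rightarrow> 'u"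
  assumes A: "operator_ideal A" and i: "inj i" and j: "inj j"
  shows "T \<in> ideal_component A \<longleftrightarrow> op_copy i j T \<in> A (bspace_copy i) (bspace_copy j)"
proof
  assume "T \<in> ideal_component A"
  then obtain i' :: "'b \<Rightarrow> 'u" and j' :: "'c \<Rightarrow> 'u"
    where i': "inj i'" and j': "inj j'"
      and T: "op_copy i' j' T \<in> A (bspace_copy i') (bspace_copy j')"
    by (auto simp: ideal_component_def)
  let ?S = "op_copy i i' id_blinfun" and ?R = "op_copy j' j id_blinfun"
  have "(\<lambda>v\<in>bs_carrier (bspace_copy i). ?R (op_copy i' j' T (?S v)))
      \<in> A (bspace_copy i) (bspace_copy j)"
    by (rule conjunct2[OF A[unfolded operator_ideal_def], rule_format,
        OF _ op_copy_bounded[OF i i'] T op_copy_bounded[OF j' j]])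
      (simp add: banach_space_on_copy i i' j j')
  moreover have "(\<lambda>v\<in>bs_carrier (bspace_copy i). ?R (op_copy i' j' T (?S v))) = op_copy i j T"
    by (rule ext) (simp add: op_copy_def bspace_copy_def restrict_def i' j')
  ultimately show "op_copy i j T \<in> A (bspace_copy i) (bspace_copy j)" by simp
next
  assume "op_copy i j T \<in> A (bspace_copy i) (bspace_copy j)"
  with i j show "T \<in> ideal_component A" by (auto simp: ideal_component_def)
qed

definition ideal_ball ::
    "('u bspace \<Rightarrow> 'u bspace \<Rightarrow> ('u \<Rightarrow> 'u) set) \<Rightarrow> real \<Rightarrow> ('b::banach \<Rightarrow>\<^sub>L 'c::banach) set" where
  "ideal_ball A lam = {T \<in> ideal_component A. norm T \<le> lam}"

definition lip_ideal ::
    "('u bspace \<Rightarrow> 'u bspace \<Rightarrow> ('u \<Rightarrow> 'u) set) \<Rightarrow> ('b::banach, 'c::banach) lip0 set" where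
  "lip_ideal A = {f. linearization f \<in> ideal_component A}"

definition lip_ideal_ball ::
    "('u bspace \<Rightarrow> 'u bspace \<Rightarrow> ('u \<Rightarrow> 'u) set) \<Rightarrow> real \<Rightarrow> ('b::banach, 'c::banach) lip0 set" where
  "lip_ideal_ball A lam = {f \<in> lip_ideal A. norm f \<le> lam}"

definition conjugate_ball ::
    "('u bspace \<Rightarrow> 'u bspace \<Rightarrow> ('u \<Rightarrow> 'u) set) \<Rightarrow> real
      \<Rightarrow> (('c::banach \<Rightarrow>\<^sub>L real) \<Rightarrow>\<^sub>L ('b::banach \<Rightarrow>\<^sub>L real)) set" where
  "conjugate_ball A lam = adjoint_op ` ideal_ball A lam"


section \<open>Bounded approximation properties\<close>

text \<open>The topology \<open>\<tau>\<^sub>c\<close> of uniform convergence on compact sets.\<close>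

definition compact_convergence :: "('b::topological_space \<Rightarrow> 'c::metric_space) topology" where
  "compact_convergence = topology (\<lambda>U. \<forall>f\<in>U. \<exists>K e. compact K \<and> 0 < e \<and>
    {g. \<forall>x\<in>K. dist (g x) (f x) < e} \<subseteq> U)"

lemma openin_compact_convergence:
  "openin compact_convergence U \<longleftrightarrow> (\<forall>f\<in>U. \<exists>K e. compact K \<and> 0 < e \<and>
    {g. \<forall>x\<in>K. dist (g x) (f x) < e} \<subseteq> U)" (is "_ \<longleftrightarrow> ?P U")
proof -
  have "istopology ?P"
    unfolding istopology_def
  proof (intro conjI allI impI ballI)
    fix U V f assume U: "?P U" and V: "?P V" and f: "f \<in> U \<inter> V"
    obtain K d where 1: "compact K" "0 < d" "{g. \<forall>x\<in>K. dist (g x) (f x) < d} \<subseteq> U"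
      using bspec[OF U, of f] f by auto
    obtain L e where 2: "compact L" "0 < e" "{g. \<forall>x\<in>L. dist (g x) (f x) < e} \<subseteq> V"
      using bspec[OF V, of f] f by auto
    show "\<exists>K e. compact K \<and> 0 < e \<and> {g. \<forall>x\<in>K. dist (g x) (f x) < e} \<subseteq> U \<inter> V"
    proof (intro exI conjI)
      show "compact (K \<union> L)" using 1(1) 2(1) by (rule compact_Un)
      show "0 < min d e" using 1(2) 2(2) by simp
      have "{g. \<forall>x\<in>K \<union> L. dist (g x) (f x) < min d e} \<subseteq> {g. \<forall>x\<in>K. dist (g x) (f x) < d}"
        "{g. \<forall>x\<in>K \<union> L. dist (g x) (f x) < min d e} \<subseteq> {g. \<forall>x\<in>L. dist (g x) (f x) < e}"
        by auto
      with 1(3) 2(3) show "{g. \<forall>x\<in>K \<union> L. dist (g x) (f x) < min d e} \<subseteq> U \<inter> V"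
        by (meson Int_greatest order_trans)
    qed
  next
    fix \<K> f assume \<K>: "\<forall>U\<in>\<K>. ?P U" and "f \<in> \<Union>\<K>"
    then obtain U where U: "U \<in> \<K>" "f \<in> U" by auto
    obtain K e where 1: "compact K" "0 < e" "{g. \<forall>x\<in>K. dist (g x) (f x) < e} \<subseteq> U"
      using bspec[OF bspec[OF \<K> U(1)] U(2)] by auto
    show "\<exists>K e. compact K \<and> 0 < e \<and> {g. \<forall>x\<in>K. dist (g x) (f x) < e} \<subseteq> \<Union>\<K>"
      by (intro exI conjI, rule 1(1), rule 1(2), rule order_trans[OF 1(3)], rule Union_upper, rule U(1))
  qed
  then show ?thesis
    unfolding compact_convergence_def by (simp add: topology_inverse')
qed

definition has_BAP ::
    "('u bspace \<Rightarrow> 'u bspace \<Rightarrow> ('u \<Rightarrow> 'u) set) \<Rightarrow> real \<Rightarrow> 'z::banach itself \<Rightarrow> bool" where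
  "has_BAP A lam _ \<longleftrightarrow>
    (id :: 'z \<Rightarrow> 'z) \<in> compact_convergence closure_of (blinfun_apply ` ideal_ball A lam)"

definition has_lip_BAP ::
    "('u bspace \<Rightarrow> 'u bspace \<Rightarrow> ('u \<Rightarrow> 'u) set) \<Rightarrow> real \<Rightarrow> 'z::banach itself \<Rightarrow> bool" where
  "has_lip_BAP A lam _ \<longleftrightarrow>
    (id :: 'z \<Rightarrow> 'z) \<in> compact_convergence closure_of (lip_apply ` lip_ideal_ball A lam)"


section \<open>The projective tensor product and the weak-star topology\<close>

text \<open>The algebraic tensor product is realized as the span of the functionals \<open>B \<mapsto> B(x,y)\<close> on the
  space of bounded bilinear forms; these forms separate its points.\<close>

lift_definition bilinear_eval :: "'a::real_normed_vector \<Rightarrow> 'b::real_normed_vector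
    \<Rightarrow> ('a \<Rightarrow>\<^sub>L 'b \<Rightarrow>\<^sub>L real) \<Rightarrow>\<^sub>L real"
  is "\<lambda>x y B. blinfun_apply (blinfun_apply B x) y"
  by (intro bounded_linear_intros)

typedef (overloaded) ('a::real_normed_vector, 'b::real_normed_vector) tensor =
  "span (range (\<lambda>(x, y). bilinear_eval x y)) :: (('a \<Rightarrow>\<^sub>L 'b \<Rightarrow>\<^sub>L real) \<Rightarrow>\<^sub>L real) set"
  by (rule exI[of _ 0]) (rule span_zero)

setup_lifting type_definition_tensor

lift_definition elementary_tensor ::
    "'a::real_normed_vector \<Rightarrow> 'b::real_normed_vector \<Rightarrow> ('a, 'b) tensor"
  is bilinear_eval
  by (rule span_base) auto

instantiation tensor :: (real_normed_vector, real_normed_vector) real_vector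
begin

lift_definition zero_tensor :: "('a, 'b) tensor" is 0 by (rule span_zero)
lift_definition plus_tensor :: "('a, 'b) tensor \<Rightarrow> ('a, 'b) tensor \<Rightarrow> ('a, 'b) tensor" is "(+)"
  by (rule span_add)
lift_definition minus_tensor :: "('a, 'b) tensor \<Rightarrow> ('a, 'b) tensor \<Rightarrow> ('a, 'b) tensor" is "(-)"
  by (rule span_diff)
lift_definition uminus_tensor :: "('a, 'b) tensor \<Rightarrow> ('a, 'b) tensor" is uminus
  by (rule span_neg)
lift_definition scaleR_tensor :: "real \<Rightarrow> ('a, 'b) tensor \<Rightarrow> ('a, 'b) tensor" is "(*\<^sub>R)"
  by (rule span_scale)

instance
  by standard (transfer, simp add: algebra_simps)+

end

lemma elementary_tensor_scale:
  "elementary_tensor (c *\<^sub>R x) y = c *\<^sub>R elementary_tensor x y"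
  by (simp add: Rep_tensor_inject[symmetric] elementary_tensor.rep_eq scaleR_tensor.rep_eq)
    (rule blinfun_eqI, simp add: bilinear_eval.rep_eq blinfun.bilinear_simps)

definition tensor_sum :: "('a \<times> 'b) list \<Rightarrow> ('a::real_normed_vector, 'b::real_normed_vector) tensor"
  where "tensor_sum zs = (\<Sum>(x, y)\<leftarrow>zs. elementary_tensor x y)"

definition tensor_cost :: "('a::real_normed_vector \<times> 'b::real_normed_vector) list \<Rightarrow> real"
  where "tensor_cost zs = (\<Sum>(x, y)\<leftarrow>zs. norm x * norm y)"

lemma tensor_cost_nonneg: "0 \<le> tensor_cost zs"
  unfolding tensor_cost_def by (rule sum_list_nonneg) auto

lemma tensor_representation: "\<exists>zs. u = tensor_sum zs"
proof -
  have "\<exists>zs. m = Rep_tensor (tensor_sum zs)"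
    if "m \<in> span (range (\<lambda>(x, y). bilinear_eval x y))" for m :: "('a \<Rightarrow>\<^sub>L 'b \<Rightarrow>\<^sub>L real) \<Rightarrow>\<^sub>L real"
    using that
  proof (induction rule: span_induct_alt)
    case base
    show ?case by (rule exI[of _ "[]"]) (simp add: tensor_sum_def zero_tensor.rep_eq)
  next
    case (step c m n)
    from step(1) obtain x y where "m = Rep_tensor (elementary_tensor x y)"
      by (auto simp: elementary_tensor.rep_eq)
    moreover from step(2) obtain zs where "n = Rep_tensor (tensor_sum zs)" by blast
    ultimately show ?case
      by (intro exI[of _ "(c *\<^sub>R x, y) # zs"])
        (simp add: tensor_sum_def elementary_tensor_scale plus_tensor.rep_eq scaleR_tensor.rep_eq)
  qed
  from this[OF Rep_tensor[of u]] show ?thesis by (simp add: Rep_tensor_inject)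
qed

lemma Rep_tensor_le_cost:
  "\<bar>blinfun_apply (Rep_tensor (tensor_sum zs)) B\<bar> \<le> tensor_cost zs * norm B"
proof (induction zs)
  case Nil
  then show ?case by (simp add: tensor_sum_def tensor_cost_def zero_tensor.rep_eq)
next
  case (Cons z zs)
  obtain x y where z: "z = (x, y)" by (cases z)
  have "norm (blinfun_apply (blinfun_apply B x) y) \<le> norm (blinfun_apply B x) * norm y"
    by (rule norm_blinfun)
  also have "\<dots> \<le> norm B * norm x * norm y"
    by (intro mult_right_mono norm_blinfun norm_ge_zero)
  finally have 1: "\<bar>blinfun_apply (blinfun_apply B x) y\<bar> \<le> norm x * norm y * norm B"
    by (simp add: mult_ac)
  have "blinfun_apply (Rep_tensor (tensor_sum (z # zs))) B =
      blinfun_apply (blinfun_apply B x) y + blinfun_apply (Rep_tensor (tensor_sum zs)) B"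
    by (simp add: tensor_sum_def z plus_tensor.rep_eq blinfun.bilinear_simps
      elementary_tensor.rep_eq bilinear_eval.rep_eq)
  moreover have "tensor_cost (z # zs) * norm B = norm x * norm y * norm B + tensor_cost zs * norm B"
    by (simp add: tensor_cost_def z algebra_simps)
  ultimately show ?case using 1 Cons.IH by linarith
qed

instantiation tensor :: (real_normed_vector, real_normed_vector) real_normed_vector
begin

text \<open>The projective norm.\<close>
definition norm_tensor :: "('a, 'b) tensor \<Rightarrow> real" where
  "norm u = (INF zs \<in> {zs. u = (\<Sum>(x, y)\<leftarrow>zs. elementary_tensor x y)}.
    (\<Sum>(x, y)\<leftarrow>zs. norm x * norm y))"

definition dist_tensor :: "('a, 'b) tensor \<Rightarrow> ('a, 'b) tensor \<Rightarrow> real" where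
  "dist_tensor u v = norm (u - v)"

definition uniformity_tensor :: "(('a, 'b) tensor \<times> ('a, 'b) tensor) filter" where
  "uniformity_tensor = (INF e\<in>{0 <..}. principal {(x, y). dist x y < e})"

definition open_tensor :: "('a, 'b) tensor set \<Rightarrow> bool" where
  "open_tensor S = (\<forall>x\<in>S. \<forall>\<^sub>F (x', y) in uniformity. x' = x \<longrightarrow> y \<in> S)"

definition sgn_tensor :: "('a, 'b) tensor \<Rightarrow> ('a, 'b) tensor" where
  "sgn_tensor u = scaleR (inverse (norm u)) u"

lemma norm_tensor_alt: "norm u = (INF zs \<in> {zs. u = tensor_sum zs}. tensor_cost zs)"
  for u :: "('a, 'b) tensor"
  by (simp add: norm_tensor_def tensor_sum_def tensor_cost_def)

lemma norm_tensor_le_cost: "norm (tensor_sum zs :: ('a, 'b) tensor) \<le> tensor_cost zs"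
  unfolding norm_tensor_alt
  by (rule cINF_lower) (auto intro!: bdd_belowI[of _ 0] tensor_cost_nonneg)

lemma le_norm_tensor:
  fixes u :: "('a, 'b) tensor"
  assumes "\<And>zs. u = tensor_sum zs \<Longrightarrow> c \<le> tensor_cost zs"
  shows "c \<le> norm u"
  unfolding norm_tensor_alt
  by (rule cINF_greatest) (use tensor_representation[of u] assms in auto)

lemma norm_tensor_approx:
  fixes u :: "('a, 'b) tensor"
  assumes "0 < e"
  obtains zs where "u = tensor_sum zs" "tensor_cost zs < norm u + e"
  using le_norm_tensor[of u "norm u + e"] assms by fastforce

lemma Rep_tensor_le_norm: "\<bar>blinfun_apply (Rep_tensor u) B\<bar> \<le> norm u * norm B"
  for u :: "('a, 'b) tensor"
proof (rule field_le_epsilon)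
  fix e :: real assume e: "0 < e"
  define d where "d = e / (norm B + 1)"
  have B: "0 < norm B + 1" by (rule add_nonneg_pos) auto
  then have "0 < d" using e by (simp add: d_def)
  then obtain zs where zs: "u = tensor_sum zs" "tensor_cost zs < norm u + d"
    by (rule norm_tensor_approx)
  have "\<bar>blinfun_apply (Rep_tensor u) B\<bar> \<le> tensor_cost zs * norm B"
    unfolding zs(1) by (rule Rep_tensor_le_cost)
  also have "\<dots> \<le> (norm u + d) * norm B"
    using zs(2) by (intro mult_right_mono) auto
  also have "\<dots> = norm u * norm B + d * norm B" by (rule distrib_right)
  also have "d * norm B \<le> d * (norm B + 1)" using \<open>0 < d\<close> by simp
  also have "d * (norm B + 1) = e" using B by (simp add: d_def)
  finally show "\<bar>blinfun_apply (Rep_tensor u) B\<bar> \<le> norm u * norm B + e" by simp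
qed

instance
proof
  fix u v :: "('a, 'b) tensor" and c :: real
  show "dist u v = norm (u - v)" by (rule dist_tensor_def)
  show "uniformity = (INF e\<in>{0 <..}. principal {(x :: ('a, 'b) tensor, y). dist x y < e})"
    by (rule uniformity_tensor_def)
  show "open S = (\<forall>x\<in>S. \<forall>\<^sub>F (x', y) in uniformity. x' = x \<longrightarrow> y \<in> S)" for S :: "('a, 'b) tensor set"
    by (rule open_tensor_def)
  show "sgn u = scaleR (inverse (norm u)) u" by (rule sgn_tensor_def)
  have nonneg: "0 \<le> norm u" for u :: "('a, 'b) tensor"
    by (rule le_norm_tensor) (rule tensor_cost_nonneg)
  show "norm u = 0 \<longleftrightarrow> u = 0"
  proof
    assume "norm u = 0"
    then have "blinfun_apply (Rep_tensor u) B = 0" for B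
      using Rep_tensor_le_norm[of u B] by simp
    then show "u = 0"
      by (simp add: Rep_tensor_inject[symmetric] zero_tensor.rep_eq blinfun_eqI)
  next
    assume "u = 0"
    then show "norm u = 0"
      using norm_tensor_le_cost[of "[]"] nonneg[of u] by (simp add: tensor_sum_def tensor_cost_def)
  qed
  show "norm (u + v) \<le> norm u + norm v"
  proof (rule field_le_epsilon)
    fix e :: real assume "0 < e"
    then have e: "0 < e / 2" by simp
    obtain zs where zs: "u = tensor_sum zs" "tensor_cost zs < norm u + e / 2"
      using e by (rule norm_tensor_approx)
    obtain ws where ws: "v = tensor_sum ws" "tensor_cost ws < norm v + e / 2"
      using e by (rule norm_tensor_approx)
    have "norm (u + v) \<le> tensor_cost (zs @ ws)"
      using norm_tensor_le_cost[of "zs @ ws"] by (simp add: zs(1) ws(1) tensor_sum_def)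
    also have "\<dots> = tensor_cost zs + tensor_cost ws" by (simp add: tensor_cost_def)
    finally show "norm (u + v) \<le> norm u + norm v + e" using zs(2) ws(2) by simp
  qed
  have le: "norm (c *\<^sub>R u) \<le> \<bar>c\<bar> * norm u" if c: "c \<noteq> 0" for c and u :: "('a, 'b) tensor"
  proof -
    have "norm (c *\<^sub>R u) / \<bar>c\<bar> \<le> norm u"
    proof (rule le_norm_tensor)
      fix zs assume u: "u = tensor_sum zs"
      let ?zs = "map (\<lambda>(x, y). (c *\<^sub>R x, y)) zs"
      have "tensor_sum ?zs = c *\<^sub>R tensor_sum zs" "tensor_cost ?zs = \<bar>c\<bar> * tensor_cost zs"
        by (induction zs)
          (auto simp: tensor_sum_def tensor_cost_def elementary_tensor_scale algebra_simps)
      then show "norm (c *\<^sub>R u) / \<bar>c\<bar> \<le> tensor_cost zs"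
        using norm_tensor_le_cost[of ?zs] c by (simp add: u divide_le_eq mult.commute)
    qed
    with c show ?thesis by (simp add: divide_le_eq mult.commute)
  qed
  show "norm (c *\<^sub>R u) = \<bar>c\<bar> * norm u"
  proof (cases "c = 0")
    case True
    then show ?thesis
      using norm_tensor_le_cost[of "[]"] nonneg[of "0 :: ('a, 'b) tensor"]
      by (simp add: tensor_sum_def tensor_cost_def)
  next
    case False
    then have "norm u \<le> \<bar>inverse c\<bar> * norm (c *\<^sub>R u)"
      using le[of "inverse c" "c *\<^sub>R u"] by simp
    with False have "\<bar>c\<bar> * norm u \<le> norm (c *\<^sub>R u)"
      by (simp add: field_simps)
    with le[of c u] False show ?thesis by simp
  qed
qed

end

text \<open>The completion of a normed space, as the closure of its canonical image in its bidual.\<close>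

lift_definition bidual_embed :: "'a::real_normed_vector \<Rightarrow> ('a \<Rightarrow>\<^sub>L real) \<Rightarrow>\<^sub>L real"
  is "\<lambda>x \<phi>. blinfun_apply \<phi> x"
  by (rule blinfun.bounded_linear_left)

lemma subspace_range_bidual_embed:
  "subspace (range (bidual_embed :: 'a::real_normed_vector \<Rightarrow> _))"
proof -
  have "linear (bidual_embed :: 'a \<Rightarrow> _)"
    by (intro linearI blinfun_eqI) (simp_all add: bidual_embed.rep_eq blinfun.bilinear_simps)
  then show "subspace (range (bidual_embed :: 'a \<Rightarrow> _))"
    by (rule linear_subspace_image) (rule subspace_UNIV)
qed

typedef (overloaded) 'a::real_normed_vector completion =
  "closure (range bidual_embed) :: (('a \<Rightarrow>\<^sub>L real) \<Rightarrow>\<^sub>L real) set"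
  by (rule exI[of _ 0]) (rule subspace_0[OF subspace_closure[OF subspace_range_bidual_embed]])

setup_lifting type_definition_completion

lemmas subspace_completion = subspace_closure[OF subspace_range_bidual_embed]

instantiation completion :: (real_normed_vector) real_normed_vector
begin

lift_definition norm_completion :: "'a completion \<Rightarrow> real" is norm .
lift_definition zero_completion :: "'a completion" is 0
  by (rule subspace_0[OF subspace_completion])
lift_definition plus_completion :: "'a completion \<Rightarrow> 'a completion \<Rightarrow> 'a completion" is "(+)"
  by (rule subspace_add[OF subspace_completion])
lift_definition minus_completion :: "'a completion \<Rightarrow> 'a completion \<Rightarrow> 'a completion" is "(-)"
  by (rule subspace_diff[OF subspace_completion])
lift_definition uminus_completion :: "'a completion \<Rightarrow> 'a completion" is uminus
  by (rule subspace_neg[OF subspace_completion])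
lift_definition scaleR_completion :: "real \<Rightarrow> 'a completion \<Rightarrow> 'a completion" is "(*\<^sub>R)"
  by (rule subspace_scale[OF subspace_completion])

definition dist_completion :: "'a completion \<Rightarrow> 'a completion \<Rightarrow> real" where
  "dist_completion f g = norm (f - g)"

definition uniformity_completion :: "('a completion \<times> 'a completion) filter" where
  "uniformity_completion = (INF e\<in>{0 <..}. principal {(x, y). dist x y < e})"

definition open_completion :: "'a completion set \<Rightarrow> bool" where
  "open_completion S = (\<forall>x\<in>S. \<forall>\<^sub>F (x', y) in uniformity. x' = x \<longrightarrow> y \<in> S)"

definition sgn_completion :: "'a completion \<Rightarrow> 'a completion" where
  "sgn_completion f = scaleR (inverse (norm f)) f"

instance
  apply standard
  unfolding dist_completion_def open_completion_def sgn_completion_def uniformity_completion_def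
  apply (rule refl | (transfer, force simp: algebra_simps norm_triangle_ineq))+
  done

end

instance completion :: (real_normed_vector) banach
proof
  fix X :: "nat \<Rightarrow> 'a completion"
  assume X: "Cauchy X"
  have D: "dist (Rep_completion x) (Rep_completion y) = dist x y" for x y :: "'a completion"
    by (simp add: dist_norm norm_completion.rep_eq minus_completion.rep_eq)
  have "Cauchy (\<lambda>n. Rep_completion (X n))"
    using X by (simp add: Cauchy_def D)
  then obtain l where l: "(\<lambda>n. Rep_completion (X n)) \<longlonglongrightarrow> l"
    by (auto simp: Cauchy_convergent_iff convergent_def)
  have "l \<in> closure (range bidual_embed)"
    by (rule closed_sequentially[OF closed_closure Rep_completion l])
  then obtain m where "l = Rep_completion m"
    by (rule Rep_completion_cases)
  with l have "X \<longlonglongrightarrow> m"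
    by (simp add: tendsto_iff D)
  then show "convergent X" by (rule convergentI)
qed

type_synonym ('a, 'b) projective_tensor = "('a, 'b) tensor completion"

text \<open>The identification of \<open>L(E, F\<^sup>*)\<close> with the dual of the projective tensor product of \<open>E\<close> and
  \<open>F\<close>: the operator \<open>T\<close> acts on the algebraic tensor product by \<open>x \<otimes> y \<mapsto> \<langle>y, T x\<rangle>\<close>, and this
  functional is extended to the completion.\<close>

lift_definition tensor_functional ::
    "('a::real_normed_vector \<Rightarrow>\<^sub>L ('b::real_normed_vector \<Rightarrow>\<^sub>L real)) \<Rightarrow> ('a, 'b) tensor \<Rightarrow>\<^sub>L real"
  is "\<lambda>T u. blinfun_apply (Rep_tensor u) T"
proof -
  fix T :: "'a \<Rightarrow>\<^sub>L ('b \<Rightarrow>\<^sub>L real)"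
  show "bounded_linear (\<lambda>u. blinfun_apply (Rep_tensor u) T)"
    by (rule bounded_linear_intro[where K = "norm T"])
      (simp_all add: plus_tensor.rep_eq scaleR_tensor.rep_eq blinfun.bilinear_simps
        Rep_tensor_le_norm)
qed

lemma tensor_functional_elementary:
  "blinfun_apply (tensor_functional T) (elementary_tensor x y) = blinfun_apply (blinfun_apply T x) y"
  by (simp add: tensor_functional.rep_eq elementary_tensor.rep_eq bilinear_eval.rep_eq)

lift_definition extend_to_completion ::
    "('a::real_normed_vector \<Rightarrow>\<^sub>L real) \<Rightarrow> 'a completion \<Rightarrow>\<^sub>L real"
  is "\<lambda>\<phi> u. blinfun_apply (Rep_completion u) \<phi>"
proof -
  fix \<phi> :: "'a \<Rightarrow>\<^sub>L real"
  have "\<bar>blinfun_apply m \<phi>\<bar> \<le> norm m * norm \<phi>" for m :: "('a \<Rightarrow>\<^sub>L real) \<Rightarrow>\<^sub>L real"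
    using norm_blinfun[of m \<phi>] by simp
  then show "bounded_linear (\<lambda>u. blinfun_apply (Rep_completion u) \<phi>)"
    by (intro bounded_linear_intro[where K = "norm \<phi>"])
      (simp_all add: plus_completion.rep_eq scaleR_completion.rep_eq norm_completion.rep_eq
        blinfun.bilinear_simps)
qed

definition projective_dual ::
    "('a::real_normed_vector \<Rightarrow>\<^sub>L ('b::real_normed_vector \<Rightarrow>\<^sub>L real))
      \<Rightarrow> ('a, 'b) projective_tensor \<Rightarrow>\<^sub>L real" where
  "projective_dual T = extend_to_completion (tensor_functional T)"

text \<open>On a dual space, the topology of pointwise convergence is the weak-star topology.\<close>
abbreviation weak_star_topology :: "('a::real_normed_vector \<Rightarrow>\<^sub>L real) topology" where
  "weak_star_topology \<equiv> strong_operator_topology"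

definition lip0_weak_star ::
    "(('a::real_normed_vector, real) lip0 \<Rightarrow>\<^sub>L ('a, real) lip0) topology" where
  "lip0_weak_star =
    pullback_topology UNIV (\<lambda>T. projective_dual (lip_to_dual o\<^sub>L T)) weak_star_topology"

end

theory Submission
  imports Defs
begin

text \<open>
  Write \<open>F\<close> for the free space of \<open>X\<close>, \<open>\<delta>\<close> for the canonical map into it, \<open>L\<^sub>f\<close> for the linearization
  of \<open>f\<close>, and \<open>\<beta>\<close> for the linearization of the identity of a Banach space, so that \<open>\<beta> \<circ> \<delta>\<close> is the identity.

  The Lipschitz and the linear approximations are exchanged by composing with these maps, and each
  exchange preserves the ideal and the norm bound. An operator \<open>T\<close> in the ideal is a Lipschitz map with
  linearization \<open>T \<circ> \<beta>\<close>, whence (b) implies (a). A Lipschitz map \<open>f\<close> on \<open>F\<close> yields \<open>f \<circ> \<delta>\<close>, whence (a)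
  implies (c). A Lipschitz map \<open>f\<close> from \<open>X\<close> to \<open>F\<close> yields the operator \<open>L\<^sub>f\<close>. If \<open>f\<close> is close to \<open>\<delta>\<close> at
  finitely many points \<open>x\<close>, then \<open>L\<^sub>f\<close> is close to the identity at the corresponding \<open>\<delta>(x)\<close>; as these
  span a dense subspace and the operators are uniformly bounded, this is enough to approximate the
  identity of \<open>F\<close> uniformly on compact sets (\<open>identity_approx_on_compact\<close>), whence (c) implies (b).
  Finally \<open>\<beta> \<circ> f\<close> approximates the identity of \<open>X\<close> when \<open>f\<close> approximates \<open>\<delta>\<close>.

  For (d), the duality pairing is \<open>\<langle>g \<otimes> \<mu>, T\<^sup>*\<rangle> = g(T \<mu>)\<close>. Elementary tensors have a dense span in the
  projective tensor product, so on norm-bounded sets the weak-star topology for the conjugates \<open>T\<^sup>*\<close>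
  is the weak operator topology for the operators \<open>T\<close>. The operators of the ideal of norm at most
  \<open>lam\<close> form a convex set, whose closures in the weak and the strong operator topology coincide
  (\<open>weak_approx_imp_strong_approx\<close>), and on bounded sets strong approximation is approximation on
  compact sets. Hence (b) and (d) are equivalent.

  Convexity enters through the Hahn--Banach theorem (\<open>separate_convex_from_zero\<close>), which is derived
  from Zorn's lemma: a minimal sublinear functional is linear. The same theorem makes the embedding
  into the bidual isometric, which gives the existence and the norm bound of \<open>L\<^sub>f\<close>.
\<close>

section \<open>Sublinear functionals and separation\<close>

text \<open>Homogeneity is required only as an inequality; the reverse one follows by rescaling, and upper
  bounds are what an infimum inherits.\<close>
definition sublinear :: "('a::real_vector \<Rightarrow> real) \<Rightarrow> bool" where
  "sublinear q \<longleftrightarrow> (\<forall>x y. q (x + y) \<le> q x + q y) \<and> (\<forall>c\<ge>0. \<forall>x. q (c *\<^sub>R x) \<le> c * q x)"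

lemma sublinear_add: "sublinear q \<Longrightarrow> q (x + y) \<le> q x + q y"
  and sublinear_scale: "sublinear q \<Longrightarrow> 0 \<le> c \<Longrightarrow> q (c *\<^sub>R x) \<le> c * q x"
  by (auto simp: sublinear_def)

lemma sublinear_zero:
  assumes "sublinear q"
  shows "q 0 = 0"
  using sublinear_add[OF assms, of 0 0] sublinear_scale[OF assms, of 0 0] by simp

lemma sublinear_uminus: "sublinear q \<Longrightarrow> - q (- x) \<le> q x"
  using sublinear_add[of q x "- x"] sublinear_zero[of q] by simp

lemma sublinear_scale_ge:
  assumes q: "sublinear q" and c: "0 \<le> c"
  shows "c * q x \<le> q (c *\<^sub>R x)"
proof (cases "c = 0")
  case True
  then show ?thesis by (simp add: sublinear_zero[OF q])
next
  case False
  with c have "q x \<le> inverse c * q (c *\<^sub>R x)"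
    using sublinear_scale[OF q, of "inverse c" "c *\<^sub>R x"] by simp
  with c False show ?thesis by (simp add: field_simps)
qed

text \<open>The members of the family need not be sublinear themselves: sums and multiples may be estimated
  by passing to another member.\<close>
lemma sublinear_INF:
  fixes Q :: "'i \<Rightarrow> 'a::real_vector \<Rightarrow> real"
  assumes I: "I \<noteq> {}"
    and bdd: "\<And>x. bdd_below ((\<lambda>i. Q i x) ` I)"
    and add: "\<And>i j x y. i \<in> I \<Longrightarrow> j \<in> I \<Longrightarrow> \<exists>k\<in>I. Q k (x + y) \<le> Q i x + Q j y"
    and scale: "\<And>i c x. i \<in> I \<Longrightarrow> 0 \<le> c \<Longrightarrow> \<exists>k\<in>I. Q k (c *\<^sub>R x) \<le> c * Q i x"
  shows "sublinear (\<lambda>x. INF i\<in>I. Q i x)"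
proof -
  define q where "q = (\<lambda>x. INF i\<in>I. Q i x)"
  have lower: "q x \<le> Q i x" if "i \<in> I" for i x
    unfolding q_def by (rule cINF_lower[OF bdd that])
  have greatest: "m \<le> q x" if "\<And>i. i \<in> I \<Longrightarrow> m \<le> Q i x" for m x
    unfolding q_def by (rule cINF_greatest[OF I that])
  have q_add: "q (x + y) \<le> Q i x + Q j y" if "i \<in> I" "j \<in> I" for i j x y
    using add[OF that] lower by (meson order_trans)
  have q_scale: "q (c *\<^sub>R x) \<le> c * Q i x" if "i \<in> I" "0 \<le> c" for i c x
    using scale[OF that] lower by (meson order_trans)
  have "q (x + y) \<le> q x + q y" for x y
  proof -
    have "q (x + y) - Q i x \<le> q y" if "i \<in> I" for i
      using q_add[OF that] by (intro greatest) (simp add: algebra_simps)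
    then have "q (x + y) - q y \<le> q x"
      by (intro greatest) (simp add: algebra_simps)
    then show ?thesis by simp
  qed
  moreover have "q (c *\<^sub>R x) \<le> c * q x" if c: "0 \<le> c" for c x
  proof (cases "c = 0")
    case True
    with I q_scale[of _ 0 x] show ?thesis by auto
  next
    case False
    with c have "q (c *\<^sub>R x) / c \<le> q x"
      using q_scale by (intro greatest) (simp add: divide_le_eq mult.commute)
    with c False show ?thesis by (simp add: divide_le_eq mult.commute)
  qed
  ultimately show ?thesis by (simp add: sublinear_def flip: q_def)
qed

text \<open>Chains of sublinear functionals have pointwise infima, since \<open>q x \<ge> - q (- x) \<ge> - p (- x)\<close> for
  every sublinear \<open>q \<le> p\<close>; so Zorn's lemma applies.\<close>
lemma minimal_sublinear:
  fixes p :: "'a::real_vector \<Rightarrow> real"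
  assumes p: "sublinear p"
  obtains q where "sublinear q" "q \<le> p" "\<And>r. sublinear r \<Longrightarrow> r \<le> q \<Longrightarrow> r = q"
proof -
  define S where "S = {q. sublinear q \<and> q \<le> p}"
  have "\<exists>m\<in>S. \<forall>r\<in>S. r \<le> m \<longrightarrow> r = m"
  proof (rule predicate_Zorn[where P = "\<lambda>a b. b \<le> a"])
    show "partial_order_on S (relation_of (\<lambda>a b. b \<le> a) S)"
      by (rule partial_order_on_relation_ofI) auto
  next
    fix C assume C: "C \<in> Chains (relation_of (\<lambda>a b. b \<le> a) S)"
    have sub: "r \<in> C \<Longrightarrow> sublinear r" and le: "r \<in> C \<Longrightarrow> r \<le> p" for r
      using C by (auto simp: Chains_def relation_of_def S_def)
    have chain: "r \<le> s \<or> s \<le> r" if "r \<in> C" "s \<in> C" for r s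
      using C that by (auto simp: Chains_def relation_of_def)
    have bdd: "bdd_below ((\<lambda>r. r x) ` C)" for x
    proof (rule bdd_belowI2)
      fix r assume "r \<in> C"
      then show "- p (- x) \<le> r x"
        using sublinear_uminus[OF sub, of r x] le_funD[OF le, of r "- x"] by linarith
    qed
    show "\<exists>u\<in>S. \<forall>a\<in>C. u \<le> a"
    proof (cases "C = {}")
      case True
      with p show ?thesis by (auto simp: S_def)
    next
      case False
      let ?u = "\<lambda>x. INF r\<in>C. r x"
      have low: "?u \<le> r" if "r \<in> C" for r
        by (rule le_funI) (rule cINF_lower[OF bdd that])
      have "sublinear ?u"
      proof (rule sublinear_INF[OF False bdd])
        fix r s x y assume rs: "r \<in> C" "s \<in> C"
        show "\<exists>k\<in>C. k (x + y) \<le> r x + s y"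
        proof (cases "r \<le> s")
          case True
          with rs show ?thesis
            using sublinear_add[OF sub, of r x y] by (intro bexI[of _ r]) (auto dest: le_funD[of _ _ y])
        next
          case False
          with chain[OF rs] rs show ?thesis
            using sublinear_add[OF sub, of s x y] by (intro bexI[of _ s]) (auto dest: le_funD[of _ _ x])
        qed
      qed (use sublinear_scale sub in blast)
      moreover obtain r where "r \<in> C" using False by blast
      then have "?u \<le> p" using low le by (meson order_trans)
      ultimately show ?thesis using low unfolding S_def by blast
    qed
  qed
  then obtain q where "q \<in> S" "\<forall>r\<in>S. r \<le> q \<longrightarrow> r = q" by blast
  then show ?thesis using that[of q] unfolding S_def by (auto intro: order_trans)
qed

text \<open>For fixed \<open>y\<close>, the functional \<open>x \<mapsto> inf\<^sub>t (q (x + t y) - t q y)\<close> over \<open>t \<ge> 0\<close> is sublinear and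
  below \<open>q\<close>. Minimality makes it equal to \<open>q\<close>, and \<open>t = 1\<close> gives \<open>q x + q y \<le> q (x + y)\<close>.\<close>
lemma minimal_sublinear_linear:
  fixes q :: "'a::real_vector \<Rightarrow> real"
  assumes q: "sublinear q" and min: "\<And>r. sublinear r \<Longrightarrow> r \<le> q \<Longrightarrow> r = q"
  shows "linear q"
proof -
  have super: "q x + q y \<le> q (x + y)" for x y
  proof -
    let ?Q = "\<lambda>t z. q (z + t *\<^sub>R y) - t * q y"
    have bdd: "bdd_below ((\<lambda>t. ?Q t z) ` {0..})" for z
    proof (rule bdd_belowI2)
      fix t :: real assume "t \<in> {0..}"
      then show "- q (- z) \<le> ?Q t z"
        using sublinear_add[OF q, of "z + t *\<^sub>R y" "- z"] sublinear_scale_ge[OF q, of t y] by simp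
    qed
    let ?r = "\<lambda>z. INF t\<in>{0..}. ?Q t z"
    have "sublinear ?r"
    proof (rule sublinear_INF[OF _ bdd])
      fix s t :: real and u v :: 'a assume st: "s \<in> {0..}" "t \<in> {0..}"
      have "?Q (s + t) (u + v) \<le> ?Q s u + ?Q t v"
        using sublinear_add[OF q, of "u + s *\<^sub>R y" "v + t *\<^sub>R y"] by (simp add: algebra_simps)
      with st show "\<exists>k\<in>{0..}. ?Q k (u + v) \<le> ?Q s u + ?Q t v"
        by (intro bexI[of _ "s + t"]) auto
    next
      fix t c :: real and u :: 'a assume t: "t \<in> {0..}" and c: "0 \<le> c"
      have "?Q (c * t) (c *\<^sub>R u) \<le> c * ?Q t u"
        using sublinear_scale[OF q c, of "u + t *\<^sub>R y"] by (simp add: algebra_simps)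
      with t c show "\<exists>k\<in>{0..}. ?Q k (c *\<^sub>R u) \<le> c * ?Q t u"
        by (intro bexI[of _ "c * t"]) auto
    qed simp
    moreover have "?r \<le> q"
      by (rule le_funI) (rule cINF_lower2[OF bdd, of 0], auto)
    ultimately have "?r = q" by (rule min)
    from fun_cong[OF this, of x] have "q x = ?r x" by (rule sym)
    also have "\<dots> \<le> ?Q 1 x" by (rule cINF_lower[OF bdd]) simp
    finally have "q x \<le> ?Q 1 x" .
    then show ?thesis by simp
  qed
  have add: "q (x + y) = q x + q y" for x y
    by (rule antisym[OF sublinear_add[OF q] super])
  have neg: "q (- x) = - q x" for x
    using add[of x "- x"] sublinear_zero[OF q] by simp
  \<comment> \<open>The bound at \<open>- x\<close> is the missing half of homogeneity.\<close>
  have nonneg: "q (c *\<^sub>R x) = c * q x" if "0 \<le> c" for c x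
    using sublinear_scale[OF q that, of x] sublinear_scale[OF q that, of "- x"] by (simp add: neg)
  have "q (c *\<^sub>R x) = c * q x" for c x
    using nonneg[of c x] nonneg[of "- c" x] neg[of "c *\<^sub>R x"] by (cases "0 \<le> c") auto
  with add show ?thesis by (intro linearI) auto
qed

text \<open>The Hahn--Banach theorem in the form of Mazur and Orlicz. The functional
  \<open>x \<mapsto> inf (\<parallel>x + t d\<parallel> - t e)\<close>, over \<open>t \<ge> 0\<close> and \<open>d \<in> D\<close>, is sublinear because \<open>D\<close> is convex, is at
  most \<open>\<parallel>x\<parallel>\<close>, and is at most \<open>- e\<close> at each \<open>- d\<close>; every linear functional below it separates.\<close>
lemma separate_convex_from_zero:
  fixes D :: "'a::real_normed_vector set"
  assumes D: "convex D" and e: "\<And>d. d \<in> D \<Longrightarrow> e \<le> norm d"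
  obtains \<phi> :: "'a \<Rightarrow>\<^sub>L real" where "norm \<phi> \<le> 1" "\<forall>d\<in>D. e \<le> blinfun_apply \<phi> d"
proof (cases "D = {}")
  case True
  then show ?thesis using that[of 0] by simp
next
  case False
  define I :: "(real \<times> 'a) set" where "I = {0..} \<times> D"
  define Q where "Q i x = norm (x + fst i *\<^sub>R snd i) - fst i * e" for i :: "real \<times> 'a" and x
  have bdd: "bdd_below ((\<lambda>i. Q i x) ` I)" for x
  proof (rule bdd_belowI2)
    fix i :: "real \<times> 'a" assume "i \<in> I"
    then obtain t d where i: "i = (t, d)" "0 \<le> t" "d \<in> D" by (auto simp: I_def)
    have "t * e \<le> norm (t *\<^sub>R d)" using e[OF i(3)] i(2) by (simp add: mult_left_mono)
    also have "\<dots> \<le> norm (x + t *\<^sub>R d) + norm x"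
      using norm_triangle_ineq4[of "x + t *\<^sub>R d" x] by simp
    finally show "- norm x \<le> Q i x" by (simp add: i Q_def)
  qed
  define p where "p = (\<lambda>x. INF i\<in>I. Q i x)"
  have "sublinear p"
    unfolding p_def
  proof (rule sublinear_INF[OF _ bdd])
    show "I \<noteq> {}" using False by (auto simp: I_def)
  next
    fix i j :: "real \<times> 'a" and x y :: 'a assume "i \<in> I" "j \<in> I"
    then obtain s c t d where i: "i = (s, c)" "0 \<le> s" "c \<in> D" and j: "j = (t, d)" "0 \<le> t" "d \<in> D"
      by (auto simp: I_def)
    obtain b where b: "b \<in> D" "(s + t) *\<^sub>R b = s *\<^sub>R c + t *\<^sub>R d"
    proof (cases "s + t = 0")
      case True
      with i j have "s = 0" "t = 0" by auto
      with i(3) show ?thesis using that[of c] by simp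
    next
      case False
      have "(s / (s + t)) *\<^sub>R c + (t / (s + t)) *\<^sub>R d \<in> D"
        using i j False by (intro convexD[OF D]) (simp_all add: add_divide_distrib[symmetric])
      moreover have "(s + t) *\<^sub>R ((s / (s + t)) *\<^sub>R c + (t / (s + t)) *\<^sub>R d) = s *\<^sub>R c + t *\<^sub>R d"
        using False by (simp add: scaleR_add_right)
      ultimately show ?thesis by (rule that)
    qed
    have "norm ((x + y) + (s + t) *\<^sub>R b) \<le> norm (x + s *\<^sub>R c) + norm (y + t *\<^sub>R d)"
      unfolding b(2) using norm_triangle_ineq[of "x + s *\<^sub>R c" "y + t *\<^sub>R d"] by (simp add: ac_simps)
    then have "Q (s + t, b) (x + y) \<le> Q i x + Q j y"
      by (simp add: Q_def i(1) j(1) distrib_right)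
    moreover have "(s + t, b) \<in> I"
      using b(1) i(2) j(2) by (simp add: I_def)
    ultimately show "\<exists>k\<in>I. Q k (x + y) \<le> Q i x + Q j y" by blast
  next
    fix i :: "real \<times> 'a" and c :: real and x :: 'a assume "i \<in> I" and c: "0 \<le> c"
    then obtain t d where i: "i = (t, d)" "0 \<le> t" "d \<in> D" by (auto simp: I_def)
    have "norm (c *\<^sub>R x + (c * t) *\<^sub>R d) = c * norm (x + t *\<^sub>R d)"
      using c norm_scaleR[of c "x + t *\<^sub>R d"] by (simp add: scaleR_add_right)
    then have "Q (c * t, d) (c *\<^sub>R x) \<le> c * Q i x"
      by (simp add: Q_def i(1) right_diff_distrib)
    moreover have "(c * t, d) \<in> I"
      using c i by (simp add: I_def)
    ultimately show "\<exists>k\<in>I. Q k (c *\<^sub>R x) \<le> c * Q i x" by blast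
  qed
  from minimal_sublinear[OF this] obtain q
    where q: "sublinear q" "q \<le> p" and min: "\<And>r. sublinear r \<Longrightarrow> r \<le> q \<Longrightarrow> r = q" by blast
  have lin: "linear q" by (rule minimal_sublinear_linear[OF q(1) min])
  have q_le: "q x \<le> Q i x" if "i \<in> I" for x and i :: "real \<times> 'a"
    using le_funD[OF q(2), of x] cINF_lower[OF bdd that, of x] by (simp add: p_def)
  have q_norm: "q x \<le> norm x" for x
  proof -
    obtain d where "d \<in> D" using False by blast
    then show ?thesis using q_le[of "(0, d)" x] by (simp add: I_def Q_def)
  qed
  have abs: "\<bar>q x\<bar> \<le> norm x" for x
    using q_norm[of x] q_norm[of "- x"] linear_neg[OF lin, of x] by (simp add: abs_le_iff)
  have bl: "bounded_linear q"
    by (rule bounded_linear_intro[where K = 1]) (auto simp: linear_add[OF lin] linear_cmul[OF lin] abs)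
  show ?thesis
  proof (rule that[of "Blinfun q"])
    show "norm (Blinfun q) \<le> 1"
      by (rule norm_blinfun_bound) (auto simp: bounded_linear_Blinfun_apply[OF bl] abs)
    show "\<forall>d\<in>D. e \<le> blinfun_apply (Blinfun q) d"
    proof
      fix d assume "d \<in> D"
      then show "e \<le> blinfun_apply (Blinfun q) d"
        using q_le[of "(1, d)" "- d"]
        by (simp add: I_def Q_def bounded_linear_Blinfun_apply[OF bl] linear_neg[OF lin])
    qed
  qed
qed


section \<open>Linearization of Lipschitz maps\<close>

text \<open>Separating the one-point set \<open>{x}\<close> from \<open>0\<close> gives a norming functional of \<open>x\<close>.\<close>
lemma norm_bidual_embed: "norm (bidual_embed x) = norm x"
proof (rule antisym)
  show "norm (bidual_embed x) \<le> norm x"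
  proof (rule norm_blinfun_bound)
    show "norm (blinfun_apply (bidual_embed x) \<phi>) \<le> norm x * norm \<phi>" for \<phi>
      using norm_blinfun[of \<phi> x] by (simp add: bidual_embed.rep_eq mult.commute)
  qed simp
next
  obtain \<phi> where \<phi>: "norm \<phi> \<le> 1" "\<forall>d\<in>{x}. norm x \<le> blinfun_apply \<phi> d"
    by (rule separate_convex_from_zero[of "{x}" "norm x"]) auto
  have "norm x \<le> blinfun_apply (bidual_embed x) \<phi>"
    using \<phi>(2) by (simp add: bidual_embed.rep_eq)
  also have "\<dots> \<le> norm (bidual_embed x) * norm \<phi>"
    using norm_blinfun[of "bidual_embed x" \<phi>] by simp
  also have "\<dots> \<le> norm (bidual_embed x)"
    using \<phi>(1) by (rule mult_left_le) simp
  finally show "norm x \<le> norm (bidual_embed x)" .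
qed

lemma bounded_linear_bidual_embed: "bounded_linear bidual_embed"
  by (rule bounded_linear_intro[where K = 1])
    (auto intro!: blinfun_eqI simp: bidual_embed.rep_eq blinfun.bilinear_simps norm_bidual_embed)

lemma closed_range_bidual_embed: "closed (range (bidual_embed :: 'a::banach \<Rightarrow> _))"
  by (intro complete_imp_closed
      complete_isometric_image[where e = 1, OF _ _ bounded_linear_bidual_embed])
    (simp_all add: norm_bidual_embed complete_UNIV)

lemma inj_bidual_embed: "inj bidual_embed"
  unfolding linear_injective_0[OF bounded_linear.linear[OF bounded_linear_bidual_embed]]
  by (metis norm_bidual_embed norm_eq_zero)

lemma closure_span_delta: "closure (span (range delta)) = (UNIV :: 'a::real_normed_vector free set)"
proof (intro equalityI subset_UNIV subsetI)
  fix \<mu> :: "'a free"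
  have D: "dist (Rep_free x) (Rep_free y) = dist x y" for x y :: "'a free"
    by (simp add: dist_norm norm_free.rep_eq minus_free.rep_eq)
  have lin: "linear (Rep_free :: 'a free \<Rightarrow> _)"
    by (intro linearI) (simp_all add: plus_free.rep_eq scaleR_free.rep_eq)
  have span: "span (range lip_eval) = Rep_free ` span (range (delta :: 'a \<Rightarrow> _))"
    by (simp add: linear_span_image[OF lin, symmetric] image_image delta.rep_eq)
  obtain s where s: "\<And>n. s n \<in> span (range lip_eval)" "s \<longlonglongrightarrow> Rep_free \<mu>"
    using Rep_free[of \<mu>] unfolding closure_sequential by blast
  from s(1) have "\<forall>n. \<exists>t. t \<in> span (range delta) \<and> s n = Rep_free t"
    unfolding span by blast
  then obtain t where t: "\<And>n. t n \<in> span (range delta)" "\<And>n. s n = Rep_free (t n)"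
    by metis
  have "t \<longlonglongrightarrow> \<mu>" using s(2) by (simp add: tendsto_iff D t(2))
  with t(1) show "\<mu> \<in> closure (span (range delta))"
    unfolding closure_sequential by blast
qed

lift_definition comp_lip0 ::
    "('b::real_normed_vector, 'c::real_normed_vector) lip0 \<Rightarrow> ('a::real_normed_vector, 'b) lip0
      \<Rightarrow> ('a, 'c) lip0"
  is "\<lambda>g f x. g (f x)"
proof (elim conjE exE, intro conjI)
  fix g :: "'b \<Rightarrow> 'c" and f :: "'a \<Rightarrow> 'b" and K L
  assume "K-lipschitz_on UNIV g" "L-lipschitz_on UNIV f"
  then have "L-lipschitz_on UNIV f" "K-lipschitz_on (range f) g"
    by (auto intro: lipschitz_on_subset)
  then have "(K * L)-lipschitz_on UNIV (\<lambda>x. g (f x))"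
    by (rule lipschitz_on_compose2)
  then show "\<exists>L. L-lipschitz_on UNIV (\<lambda>x. g (f x))" ..
qed simp

lemma norm_comp_lip0: "norm (comp_lip0 g f) \<le> norm g * norm f"
proof (rule norm_lip0_le)
  fix x y
  have "norm (lip_apply g (lip_apply f x) - lip_apply g (lip_apply f y))
      \<le> norm g * norm (lip_apply f x - lip_apply f y)"
    by (rule lip_norm)
  also have "\<dots> \<le> norm g * (norm f * norm (x - y))"
    by (intro mult_left_mono lip_norm norm_lip0_nonneg)
  finally show "norm (lip_apply (comp_lip0 g f) x - lip_apply (comp_lip0 g f) y)
      \<le> norm g * norm f * norm (x - y)"
    by (simp add: comp_lip0.rep_eq mult.assoc)
qed simp

lift_definition lip0_of_blinfun ::
    "('a::real_normed_vector \<Rightarrow>\<^sub>L 'b::real_normed_vector) \<Rightarrow> ('a, 'b) lip0"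
  is blinfun_apply
proof
  fix T :: "'a \<Rightarrow>\<^sub>L 'b"
  have "(norm T)-lipschitz_on UNIV (blinfun_apply T)"
    by (rule lipschitz_onI) (simp_all add: dist_norm norm_blinfun flip: blinfun.diff_right)
  then show "\<exists>L. L-lipschitz_on UNIV (blinfun_apply T)" ..
qed (simp add: blinfun.bilinear_simps)

lemma norm_lip0_of_blinfun: "norm (lip0_of_blinfun T) \<le> norm T"
  by (rule norm_lip0_le) (simp_all add: lip0_of_blinfun.rep_eq norm_blinfun flip: blinfun.diff_right)

abbreviation blinfun_comp_lip0 ::
    "('b::real_normed_vector \<Rightarrow>\<^sub>L 'c::real_normed_vector) \<Rightarrow> ('a::real_normed_vector, 'b) lip0
      \<Rightarrow> ('a, 'c) lip0" where
  "blinfun_comp_lip0 T f \<equiv> comp_lip0 (lip0_of_blinfun T) f"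

lemma norm_blinfun_comp_lip0: "norm (blinfun_comp_lip0 T f) \<le> norm T * norm f"
  using norm_comp_lip0[of "lip0_of_blinfun T" f] mult_right_mono[OF norm_lip0_of_blinfun[of T], of "norm f"]
  by simp

lift_definition delta_lip0 :: "('a::real_normed_vector, 'a free) lip0" is delta
proof
  have "1-lipschitz_on UNIV (delta :: 'a \<Rightarrow> _)"
    by (rule lipschitz_onI) (simp_all add: dist_norm norm_delta_diff_le)
  then show "\<exists>L. L-lipschitz_on UNIV (delta :: 'a \<Rightarrow> _)" ..
qed (rule delta_0)

lemma norm_delta_lip0: "norm delta_lip0 \<le> 1"
  by (rule norm_lip0_le) (simp_all add: delta_lip0.rep_eq norm_delta_diff_le)

lift_definition lip_adjoint ::
    "('a::real_normed_vector, 'b::real_normed_vector) lip0 \<Rightarrow> ('b \<Rightarrow>\<^sub>L real) \<Rightarrow>\<^sub>L ('a, real) lip0"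
  is "\<lambda>f \<phi>. blinfun_comp_lip0 \<phi> f"
  by (rule bounded_linear_intro)
    (auto intro!: lip0_eqI norm_blinfun_comp_lip0
      simp: comp_lip0.rep_eq lip0_of_blinfun.rep_eq plus_lip0.rep_eq scaleR_lip0.rep_eq blinfun.bilinear_simps)

lemma norm_lip_adjoint: "norm (lip_adjoint f) \<le> norm f"
  using norm_blinfun_comp_lip0[of _ f]
  by (intro norm_blinfun_bound norm_lip0_nonneg) (simp add: lip_adjoint.rep_eq mult.commute)

text \<open>Every \<open>\<mu>\<close> in the free space is a functional on \<open>Lip\<^sub>0(X)\<close>, so it acts on the functions \<open>\<phi> \<circ> f\<close>. In the
  bidual, \<open>L\<^sub>f \<mu>\<close> is thus given by a formula, and no extension by continuity from finite combinations
  of the \<open>\<delta>\<^sub>x\<close> is involved.\<close>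
lift_definition bidual_linearization ::
    "('a::real_normed_vector, 'b::real_normed_vector) lip0
      \<Rightarrow> 'a free \<Rightarrow>\<^sub>L (('b \<Rightarrow>\<^sub>L real) \<Rightarrow>\<^sub>L real)"
  is "\<lambda>f \<mu>. Rep_free \<mu> o\<^sub>L lip_adjoint f"
proof (rule bounded_linear_intro)
  fix f :: "('a, 'b) lip0" and \<mu> :: "'a free"
  show "norm (Rep_free \<mu> o\<^sub>L lip_adjoint f) \<le> norm \<mu> * norm (lip_adjoint f)"
    unfolding norm_free.rep_eq by (rule norm_blinfun_compose)
qed (auto intro!: blinfun_eqI simp: plus_free.rep_eq scaleR_free.rep_eq blinfun.bilinear_simps)

lemma norm_bidual_linearization: "norm (blinfun_apply (bidual_linearization f) \<mu>) \<le> norm f * norm \<mu>"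
proof -
  have "norm (blinfun_apply (bidual_linearization f) \<mu>) \<le> norm \<mu> * norm (lip_adjoint f)"
    unfolding norm_free.rep_eq bidual_linearization.rep_eq by (rule norm_blinfun_compose)
  also have "\<dots> \<le> norm \<mu> * norm f"
    by (intro mult_left_mono norm_lip_adjoint norm_ge_zero)
  finally show ?thesis by (simp add: mult.commute)
qed

lemma bidual_linearization_delta:
  "blinfun_apply (bidual_linearization f) (delta x) = bidual_embed (lip_apply f x)"
  by (rule blinfun_eqI)
    (simp add: bidual_linearization.rep_eq delta.rep_eq lip_eval.rep_eq lip_adjoint.rep_eq
      comp_lip0.rep_eq lip0_of_blinfun.rep_eq bidual_embed.rep_eq)

text \<open>Since \<open>Y\<close> is complete, its image in the bidual is closed; it contains the images of all
  \<open>\<delta>\<^sub>x\<close>, hence those of all elements of the free space.\<close>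
lemma bidual_linearization_range:
  fixes f :: "('a::real_normed_vector, 'b::banach) lip0"
  shows "blinfun_apply (bidual_linearization f) \<mu> \<in> range bidual_embed"
proof -
  let ?\<Phi> = "blinfun_apply (bidual_linearization f)"
  let ?V = "?\<Phi> -` range bidual_embed"
  have "subspace ?V"
    by (intro linear_subspace_vimage subspace_range_bidual_embed bounded_linear.linear[OF blinfun.bounded_linear_right])
  then have "span (range delta) \<subseteq> ?V"
    by (intro span_minimal) (auto simp: bidual_linearization_delta)
  moreover have "closed ?V"
    by (intro closed_vimage closed_range_bidual_embed) (simp add: blinfun.continuous_on)
  ultimately have "closure (span (range delta)) \<subseteq> ?V"
    by (rule closure_minimal)
  then show ?thesis by (auto simp: closure_span_delta)
qed

lemma linearization_exists:
  fixes f :: "('a::real_normed_vector, 'b::banach) lip0"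
  obtains L where "\<And>x. blinfun_apply L (delta x) = lip_apply f x" "norm L \<le> norm f"
proof -
  let ?\<Phi> = "blinfun_apply (bidual_linearization f)"
  define L where "L \<mu> = inv bidual_embed (?\<Phi> \<mu>)" for \<mu>
  have embed: "bidual_embed (L \<mu>) = ?\<Phi> \<mu>" for \<mu>
    unfolding L_def using bidual_linearization_range by (rule f_inv_into_f)
  have lin: "linear bidual_embed"
    by (rule bounded_linear.linear[OF bounded_linear_bidual_embed])
  have norm_L: "norm (L \<mu>) \<le> norm f * norm \<mu>" for \<mu>
    using norm_bidual_linearization[of f \<mu>] by (simp add: norm_bidual_embed flip: embed)
  have bl: "bounded_linear L"
  proof (rule bounded_linear_intro)
    show "norm (L \<mu>) \<le> norm \<mu> * norm f" for \<mu>
      using norm_L[of \<mu>] by (simp add: mult.commute)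
  qed (rule injD[OF inj_bidual_embed],
      simp add: linear_add[OF lin] linear_cmul[OF lin] embed blinfun.bilinear_simps)+
  show ?thesis
  proof (rule that)
    show "blinfun_apply (Blinfun L) (delta x) = lip_apply f x" for x
      by (simp add: bounded_linear_Blinfun_apply[OF bl] L_def bidual_linearization_delta
          inv_f_f[OF inj_bidual_embed])
    show "norm (Blinfun L) \<le> norm f"
      by (intro norm_blinfun_bound norm_lip0_nonneg)
        (simp add: bounded_linear_Blinfun_apply[OF bl] norm_L)
  qed
qed

lemma linearization_delta: "blinfun_apply (linearization f) (delta x) = lip_apply f x"
  and norm_linearization_le: "norm (linearization f) \<le> norm f"
proof -
  obtain L where L: "\<And>x. blinfun_apply L (delta x) = lip_apply f x" "norm L \<le> norm f"
    using linearization_exists[of f] by blast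
  then have "linearization f = L" by (intro linearization_eqI)
  with L show "blinfun_apply (linearization f) (delta x) = lip_apply f x"
    "norm (linearization f) \<le> norm f" by auto
qed

lemma linearization_blinfun_comp:
  "linearization (blinfun_comp_lip0 T f) = T o\<^sub>L linearization f"
  by (rule linearization_eqI) (simp add: comp_lip0.rep_eq lip0_of_blinfun.rep_eq linearization_delta)

text \<open>The right factor \<open>f\<close> turns into an operator between free spaces, the linearization of \<open>\<delta> \<circ> f\<close>. Thus
  \<open>L\<^sub>g\<close> is a factor of the linearization of \<open>g \<circ> f\<close>, and an ideal containing \<open>L\<^sub>g\<close> contains the latter.\<close>
lemma linearization_comp:
  "linearization (comp_lip0 g f) = linearization g o\<^sub>L linearization (comp_lip0 delta_lip0 f)"
  by (rule linearization_eqI) (simp add: comp_lip0.rep_eq delta_lip0.rep_eq linearization_delta)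

text \<open>For a Banach space \<open>X\<close>, the linear left inverse \<open>\<beta>\<close> of \<open>\<delta>\<^sub>X\<close>.\<close>
definition barycenter :: "'a::banach free \<Rightarrow>\<^sub>L 'a" where
  "barycenter = linearization (lip0_of_blinfun id_blinfun)"

lemma barycenter_delta: "blinfun_apply barycenter (delta x) = x"
  by (simp add: barycenter_def linearization_delta lip0_of_blinfun.rep_eq)

lemma norm_barycenter: "norm barycenter \<le> 1"
proof -
  have "norm (lip0_of_blinfun (id_blinfun :: 'a \<Rightarrow>\<^sub>L 'a)) \<le> 1"
    by (rule norm_lip0_le) (simp_all add: lip0_of_blinfun.rep_eq)
  then show ?thesis
    unfolding barycenter_def using norm_linearization_le order_trans by blast
qed

lemma linearization_of_blinfun: "linearization (lip0_of_blinfun T) = T o\<^sub>L barycenter"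
  by (rule linearization_eqI) (simp add: lip0_of_blinfun.rep_eq barycenter_delta)


section \<open>Approximation on compact and on finite sets\<close>

text \<open>The set of maps strictly within \<open>e\<close> of \<open>f\<close> at every point of \<open>K\<close> need not be open, since the
  distances may accumulate at \<open>e\<close>; its subset of maps with a uniform margin is.\<close>
lemma compact_convergence_closure_iff:
  fixes f :: "'a::topological_space \<Rightarrow> 'b::metric_space"
  shows "f \<in> compact_convergence closure_of S \<longleftrightarrow>
    (\<forall>K e. compact K \<longrightarrow> 0 < e \<longrightarrow> (\<exists>g\<in>S. \<forall>x\<in>K. dist (g x) (f x) < e))"
proof (intro iffI allI impI)
  fix K :: "'a set" and e :: real
  assume f: "f \<in> compact_convergence closure_of S" and K: "compact K" and e: "0 < e"
  let ?U = "{g. \<exists>d<e. \<forall>x\<in>K. dist (g x) (f x) \<le> d}"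
  have "openin compact_convergence ?U"
    unfolding openin_compact_convergence
  proof
    fix g assume "g \<in> ?U"
    then obtain d where d: "d < e" "\<forall>x\<in>K. dist (g x) (f x) \<le> d" by auto
    have "h \<in> ?U" if h: "\<forall>x\<in>K. dist (h x) (g x) < (e - d) / 2" for h
    proof -
      have "dist (h x) (f x) \<le> (e - d) / 2 + d" if "x \<in> K" for x
        using dist_triangle[of "h x" "f x" "g x"] bspec[OF h that] bspec[OF d(2) that] by linarith
      moreover have "(e - d) / 2 + d < e" using d(1) by (simp add: field_simps)
      ultimately show ?thesis by blast
    qed
    with K d(1) show "\<exists>K e. compact K \<and> 0 < e \<and> {h. \<forall>x\<in>K. dist (h x) (g x) < e} \<subseteq> ?U"
      by (intro exI[of _ K] exI[of _ "(e - d) / 2"]) auto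
  qed
  moreover have "f \<in> ?U" using e by (intro CollectI exI[of _ 0]) simp
  moreover have "\<forall>U. f \<in> U \<and> openin compact_convergence U \<longrightarrow> (\<exists>g. g \<in> S \<and> g \<in> U)"
    using f by (simp add: in_closure_of)
  ultimately obtain g where "g \<in> S" "g \<in> ?U" by meson
  then show "\<exists>g\<in>S. \<forall>x\<in>K. dist (g x) (f x) < e"
    by (intro bexI[of _ g]) auto
next
  assume approx: "\<forall>K e. compact K \<longrightarrow> 0 < e \<longrightarrow> (\<exists>g\<in>S. \<forall>x\<in>K. dist (g x) (f x) < e)"
  have "openin compact_convergence (UNIV :: ('a \<Rightarrow> 'b) set)"
    unfolding openin_compact_convergence using compact_empty zero_less_one by blast
  then have "f \<in> topspace compact_convergence"
    by (rule subsetD[OF openin_subset]) simp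
  moreover have "\<exists>g. g \<in> S \<and> g \<in> U" if fU: "f \<in> U" "openin compact_convergence U" for U
  proof -
    obtain K e where K: "compact K" "0 < e" and U: "{g. \<forall>x\<in>K. dist (g x) (f x) < e} \<subseteq> U"
      using bspec[OF fU(2)[unfolded openin_compact_convergence] fU(1)] by (elim exE conjE)
    obtain g where "g \<in> S" "\<forall>x\<in>K. dist (g x) (f x) < e"
      using approx[rule_format, OF K] by (elim bexE)
    with U show ?thesis by (intro exI[of _ g]) (simp add: subset_iff)
  qed
  ultimately show "f \<in> compact_convergence closure_of S"
    by (simp add: in_closure_of)
qed

text \<open>The defect \<open>T y - y\<close> is linear in \<open>y\<close>, so on a finite combination it is bounded by a constant
  times the defects of its terms. The constant has to be independent of \<open>T\<close>.\<close>
lemma span_almost_fixed: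
  fixes M :: "'a::real_normed_vector set"
  assumes "y \<in> span M"
  obtains F C where "finite F" "F \<subseteq> M" "0 \<le> C"
    "\<And>T d. (\<forall>x\<in>F. norm (blinfun_apply T x - x) \<le> d) \<Longrightarrow> 0 \<le> d \<Longrightarrow> norm (blinfun_apply T y - y) \<le> C * d"
proof -
  have "\<exists>F C. finite F \<and> F \<subseteq> M \<and> 0 \<le> C \<and> (\<forall>T d. (\<forall>x\<in>F. norm (blinfun_apply T x - x) \<le> d) \<longrightarrow>
      0 \<le> d \<longrightarrow> norm (blinfun_apply T y - y) \<le> C * d)"
    using assms
  proof (induction rule: span_induct_alt)
    case base
    show ?case by (rule exI[of _ "{}"]) (auto intro: exI[of _ 0] simp: blinfun.bilinear_simps)
  next
    case (step c x y)
    from step(2) obtain F C where F: "finite F" "F \<subseteq> M" "0 \<le> C"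
      and C: "\<And>T d. (\<forall>x\<in>F. norm (blinfun_apply T x - x) \<le> d) \<Longrightarrow> 0 \<le> d \<Longrightarrow>
        norm (blinfun_apply T y - y) \<le> C * d" by blast
    have "norm (blinfun_apply T (c *\<^sub>R x + y) - (c *\<^sub>R x + y)) \<le> (\<bar>c\<bar> + C) * d"
      if T: "\<forall>z\<in>insert x F. norm (blinfun_apply T z - z) \<le> d" and d: "0 \<le> d" for T d
    proof -
      have "blinfun_apply T (c *\<^sub>R x + y) - (c *\<^sub>R x + y)
          = c *\<^sub>R (blinfun_apply T x - x) + (blinfun_apply T y - y)"
        by (simp add: blinfun.bilinear_simps algebra_simps)
      also have "norm \<dots> \<le> \<bar>c\<bar> * norm (blinfun_apply T x - x) + norm (blinfun_apply T y - y)"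
        by (rule order_trans[OF norm_triangle_ineq]) simp
      also have "\<dots> \<le> \<bar>c\<bar> * d + C * d"
        using T d by (intro add_mono mult_left_mono C) auto
      finally show ?thesis by (simp add: distrib_right)
    qed
    with step(1) F show ?case
      by (intro exI[of _ "insert x F"] exI[of _ "\<bar>c\<bar> + C"]) auto
  qed
  then show ?thesis using that by blast
qed

lemma finite_almost_fixed:
  fixes M :: "'a::real_normed_vector set"
  assumes "finite Y" "Y \<subseteq> span M" "0 < e"
  obtains F d where "finite F" "F \<subseteq> M" "0 < d"
    "\<And>T y. (\<forall>x\<in>F. norm (blinfun_apply T x - x) \<le> d) \<Longrightarrow> y \<in> Y \<Longrightarrow> norm (blinfun_apply T y - y) \<le> e"
proof -
  have "\<exists>F d. finite F \<and> F \<subseteq> M \<and> 0 < d \<and> (\<forall>T. (\<forall>x\<in>F. norm (blinfun_apply T x - x) \<le> d) \<longrightarrow>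
      (\<forall>y\<in>Y. norm (blinfun_apply T y - y) \<le> e))"
    using assms(1,2)
  proof (induction rule: finite_induct)
    case empty
    show ?case by (rule exI[of _ "{}"]) (auto intro: exI[of _ 1])
  next
    case (insert y Y)
    then obtain F d where F: "finite F" "F \<subseteq> M" "0 < d"
      and d: "\<And>T. (\<forall>x\<in>F. norm (blinfun_apply T x - x) \<le> d) \<Longrightarrow>
        (\<forall>y\<in>Y. norm (blinfun_apply T y - y) \<le> e)" by blast
    from insert.prems have "y \<in> span M" by simp
    then obtain G C where G: "finite G" "G \<subseteq> M" "0 \<le> C"
      and C: "\<And>T d. (\<forall>x\<in>G. norm (blinfun_apply T x - x) \<le> d) \<Longrightarrow> 0 \<le> d \<Longrightarrow>
        norm (blinfun_apply T y - y) \<le> C * d" by (rule span_almost_fixed) blast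
    define d' where "d' = min d (e / (C + 1))"
    have d': "0 < d'" "d' \<le> d" using F(3) G(3) \<open>0 < e\<close> by (auto simp: d'_def)
    have "C * d' \<le> (C + 1) * (e / (C + 1))"
      using G(3) d'(1) by (intro mult_mono) (auto simp: d'_def)
    also have "\<dots> = e" using G(3) by simp
    finally have "C * d' \<le> e" .
    have "\<forall>z\<in>insert y Y. norm (blinfun_apply T z - z) \<le> e"
      if T: "\<forall>x\<in>F \<union> G. norm (blinfun_apply T x - x) \<le> d'" for T
    proof -
      have "norm (blinfun_apply T y - y) \<le> C * d'" using T d'(1) by (intro C) auto
      moreover have "\<forall>z\<in>Y. norm (blinfun_apply T z - z) \<le> e" using T d'(2) by (intro d) force
      ultimately show ?thesis using \<open>C * d' \<le> e\<close> by auto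
    qed
    with F G d'(1) show ?case
      by (intro exI[of _ "F \<union> G"] exI[of _ d']) auto
  qed
  then show ?thesis using that by blast
qed

text \<open>On norm-bounded sets of operators, being close to the identity is controlled by finitely many
  vectors of a set with dense span: operators of norm at most \<open>lam\<close> are equicontinuous, and a
  compact set is covered by finitely many small balls around points of the span.\<close>
lemma identity_approx_on_compact:
  fixes M :: "'a::real_normed_vector set" and B :: "('a \<Rightarrow>\<^sub>L 'a) set"
  assumes bound: "\<And>T. T \<in> B \<Longrightarrow> norm T \<le> lam" and lam: "0 \<le> lam"
    and dense: "closure (span M) = UNIV"
    and approx: "\<And>F d. finite F \<Longrightarrow> F \<subseteq> M \<Longrightarrow> 0 < d \<Longrightarrow>
      \<exists>T\<in>B. \<forall>x\<in>F. norm (blinfun_apply T x - x) < d"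
    and K: "compact K" and e: "0 < e"
  shows "\<exists>T\<in>B. \<forall>x\<in>K. norm (blinfun_apply T x - x) < e"
proof -
  \<comment> \<open>Replacing \<open>x\<close> by a point at distance less than \<open>r\<close> changes \<open>T x - x\<close> by less than \<open>(lam + 1) r = e / 2\<close>.\<close>
  define r where "r = inverse (lam + 1) * (e / 2)"
  have r: "0 < r" using e lam by (simp add: r_def)
  have cover: "K \<subseteq> (\<Union>y\<in>span M. ball y r)"
  proof
    fix x
    have "x \<in> closure (span M)" using dense by simp
    then obtain y where "y \<in> span M" "dist y x < r"
      using r unfolding closure_approachable by blast
    then show "x \<in> (\<Union>y\<in>span M. ball y r)" by auto
  qed
  obtain Y where Y: "Y \<subseteq> span M" "finite Y" "K \<subseteq> (\<Union>y\<in>Y. ball y r)"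
    by (rule compactE_image[OF K _ cover]) auto
  from Y(2,1) half_gt_zero[OF e] obtain F d where F: "finite F" "F \<subseteq> M" "0 < d"
    and fixed: "\<And>T y. (\<forall>x\<in>F. norm (blinfun_apply T x - x) \<le> d) \<Longrightarrow> y \<in> Y \<Longrightarrow>
      norm (blinfun_apply T y - y) \<le> e / 2"
    by (rule finite_almost_fixed) blast
  obtain T where T: "T \<in> B" "\<forall>x\<in>F. norm (blinfun_apply T x - x) < d"
    using approx[OF F] by blast
  have "norm (blinfun_apply T x - x) < e" if "x \<in> K" for x
  proof -
    from that Y(3) obtain y where y: "y \<in> Y" "norm (x - y) < r"
      by (auto simp: dist_norm norm_minus_commute)
    have "norm (blinfun_apply T x - x) = norm (blinfun_apply T (x - y) + ((blinfun_apply T y - y) - (x - y)))"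
      by (simp add: blinfun.bilinear_simps)
    also have "\<dots> \<le> norm (blinfun_apply T (x - y)) + (norm (blinfun_apply T y - y) + norm (x - y))"
      by (intro order_trans[OF norm_triangle_ineq] add_left_mono norm_triangle_ineq4)
    also have "norm (blinfun_apply T (x - y)) \<le> lam * norm (x - y)"
      by (intro order_trans[OF norm_blinfun] mult_right_mono bound T norm_ge_zero)
    also have "norm (blinfun_apply T y - y) \<le> e / 2"
      using T(2) y(1) by (intro fixed) (auto intro: less_imp_le)
    also have "lam * norm (x - y) + (e / 2 + norm (x - y)) = (lam + 1) * norm (x - y) + e / 2"
      by (simp add: algebra_simps)
    also have "(lam + 1) * norm (x - y) < (lam + 1) * r"
      using y(2) lam by (intro mult_strict_left_mono) auto
    also have "(lam + 1) * r = e / 2" using lam by (simp add: r_def)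
    finally show ?thesis by simp
  qed
  with T(1) show ?thesis by blast
qed


section \<open>Operator ideals on Banach spaces given as types\<close>

lemma ideal_component_add:
  fixes A :: "'u bspace \<Rightarrow> 'u bspace \<Rightarrow> ('u \<Rightarrow> 'u) set" and S T :: "'b::banach \<Rightarrow>\<^sub>L 'c::banach"
  assumes A: "operator_ideal A" and S: "S \<in> ideal_component A" and T: "T \<in> ideal_component A"
  shows "S + T \<in> ideal_component A"
proof -
  from S obtain i :: "'b \<Rightarrow> 'u" and j :: "'c \<Rightarrow> 'u" where ij: "inj i" "inj j"
    by (auto simp: ideal_component_def)
  have "(\<lambda>v\<in>bs_carrier (bspace_copy i). bs_add (bspace_copy j) (op_copy i j S v) (op_copy i j T v))
      \<in> A (bspace_copy i) (bspace_copy j)"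
    by (rule conjunct1[OF A[unfolded operator_ideal_def], rule_format, THEN conjunct2, THEN conjunct2,
        THEN conjunct1, rule_format])
      (simp_all add: banach_space_on_copy ij S T flip: ideal_component_iff[OF A ij])
  moreover have "(\<lambda>v\<in>bs_carrier (bspace_copy i). bs_add (bspace_copy j) (op_copy i j S v) (op_copy i j T v))
      = op_copy i j (S + T)"
    by (rule ext) (simp add: op_copy_def bspace_copy_def restrict_def ij blinfun.bilinear_simps)
  ultimately show ?thesis by (simp add: ideal_component_iff[OF A ij])
qed

lemma ideal_component_scaleR:
  fixes A :: "'u bspace \<Rightarrow> 'u bspace \<Rightarrow> ('u \<Rightarrow> 'u) set" and T :: "'b::banach \<Rightarrow>\<^sub>L 'c::banach"
  assumes A: "operator_ideal A" and T: "T \<in> ideal_component A"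
  shows "c *\<^sub>R T \<in> ideal_component A"
proof -
  from T obtain i :: "'b \<Rightarrow> 'u" and j :: "'c \<Rightarrow> 'u" where ij: "inj i" "inj j"
    by (auto simp: ideal_component_def)
  have "(\<lambda>v\<in>bs_carrier (bspace_copy i). bs_scale (bspace_copy j) c (op_copy i j T v))
      \<in> A (bspace_copy i) (bspace_copy j)"
    by (rule conjunct1[OF A[unfolded operator_ideal_def], rule_format, THEN conjunct2, THEN conjunct2,
        THEN conjunct2, rule_format])
      (simp_all add: banach_space_on_copy ij T flip: ideal_component_iff[OF A ij])
  moreover have "(\<lambda>v\<in>bs_carrier (bspace_copy i). bs_scale (bspace_copy j) c (op_copy i j T v))
      = op_copy i j (c *\<^sub>R T)"
    by (rule ext) (simp add: op_copy_def bspace_copy_def restrict_def ij blinfun.bilinear_simps)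
  ultimately show ?thesis by (simp add: ideal_component_iff[OF A ij])
qed

text \<open>The outer spaces must fit into the universe for the composition to be an operator that the
  ideal speaks about.\<close>
lemma ideal_component_compose:
  fixes A :: "'u bspace \<Rightarrow> 'u bspace \<Rightarrow> ('u \<Rightarrow> 'u) set"
    and i0 :: "'a::banach \<Rightarrow> 'u" and j0 :: "'d::banach \<Rightarrow> 'u"
    and S :: "'a \<Rightarrow>\<^sub>L 'b::banach" and T :: "'b \<Rightarrow>\<^sub>L 'c::banach" and R :: "'c \<Rightarrow>\<^sub>L 'd"
  assumes A: "operator_ideal A" and i0: "inj i0" and j0: "inj j0" and T: "T \<in> ideal_component A"
  shows "R o\<^sub>L T o\<^sub>L S \<in> ideal_component A"
proof -
  from T obtain i :: "'b \<Rightarrow> 'u" and j :: "'c \<Rightarrow> 'u" where i: "inj i" and j: "inj j"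
    by (auto simp: ideal_component_def)
  have T': "op_copy i j T \<in> A (bspace_copy i) (bspace_copy j)"
    using T by (simp add: ideal_component_iff[OF A i j])
  have "(\<lambda>v\<in>bs_carrier (bspace_copy i0). op_copy j j0 R (op_copy i j T (op_copy i0 i S v)))
      \<in> A (bspace_copy i0) (bspace_copy j0)"
    by (rule conjunct2[OF A[unfolded operator_ideal_def], rule_format,
        OF _ op_copy_bounded[OF i0 i] T' op_copy_bounded[OF j j0]])
      (simp add: banach_space_on_copy i i0 j j0)
  moreover have "(\<lambda>v\<in>bs_carrier (bspace_copy i0). op_copy j j0 R (op_copy i j T (op_copy i0 i S v)))
      = op_copy i0 j0 (R o\<^sub>L T o\<^sub>L S)"
    by (rule ext) (simp add: op_copy_def bspace_copy_def restrict_def i j i0 j0)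
  ultimately show ?thesis by (simp add: ideal_component_iff[OF A i0 j0])
qed

lemma convex_ideal_ball:
  assumes A: "operator_ideal A"
  shows "convex (ideal_ball A lam :: ('b::banach \<Rightarrow>\<^sub>L 'c::banach) set)"
proof (rule convexI)
  fix S T :: "'b \<Rightarrow>\<^sub>L 'c" and s t :: real
  assume ST: "S \<in> ideal_ball A lam" "T \<in> ideal_ball A lam" and st: "0 \<le> s" "0 \<le> t" "s + t = 1"
  have "norm (s *\<^sub>R S + t *\<^sub>R T) \<le> s * norm S + t * norm T"
    using norm_triangle_ineq[of "s *\<^sub>R S" "t *\<^sub>R T"] st by simp
  also have "\<dots> \<le> s * lam + t * lam"
    using ST st by (intro add_mono mult_left_mono) (auto simp: ideal_ball_def)
  also have "\<dots> = lam" using st(3) by (simp flip: distrib_right)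
  finally show "s *\<^sub>R S + t *\<^sub>R T \<in> ideal_ball A lam"
    using ST by (simp add: ideal_ball_def ideal_component_add[OF A] ideal_component_scaleR[OF A])
qed


section \<open>Weak and strong approximation by convex sets of operators\<close>

definition bcontfun_single :: "nat \<Rightarrow> 'b::real_normed_vector \<Rightarrow> (nat \<Rightarrow>\<^sub>C 'b)" where
  "bcontfun_single i y = Bcontfun (\<lambda>j. if j = i then y else 0)"

lemma apply_bcontfun_single: "apply_bcontfun (bcontfun_single i y) j = (if j = i then y else 0)"
proof -
  have "(\<lambda>j. if j = i then y else 0) \<in> bcontfun"
    by (rule bcontfun_normI[where b = "norm y"]) auto
  then show ?thesis
    by (simp add: bcontfun_single_def Bcontfun_inverse)
qed

lemma bounded_linear_bcontfun_single: "bounded_linear (bcontfun_single i)"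
proof (rule bounded_linear_intro[where K = 1])
  show "norm (bcontfun_single i y) \<le> norm y * 1" for y
    by (rule norm_bound) (simp add: apply_bcontfun_single)
qed (auto intro!: bcontfun_eqI simp: apply_bcontfun_single)

lemma apply_bcontfun_sum: "apply_bcontfun (\<Sum>i\<in>I. f i) j = (\<Sum>i\<in>I. apply_bcontfun (f i) j)"
  by (induction I rule: infinite_finite_induct) auto

text \<open>A form of Mazur's theorem: for convex sets of operators, approximation in the weak operator
  topology implies approximation in the strong one. Values at finitely many vectors are collected
  into a bounded sequence, so that separation in the space of bounded sequences gives one functional
  for each vector.\<close>
lemma weak_approx_imp_strong_approx:
  fixes B :: "('a::real_normed_vector \<Rightarrow>\<^sub>L 'b::real_normed_vector) set"
  assumes B: "convex B" and M: "finite M" and e: "0 < e"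
    and weak: "\<And>(\<Phi> :: ('b \<Rightarrow>\<^sub>L real) set) d. finite \<Phi> \<Longrightarrow> 0 < d \<Longrightarrow>
      \<exists>T\<in>B. \<forall>\<phi>\<in>\<Phi>. \<forall>x\<in>M. \<bar>blinfun_apply \<phi> (blinfun_apply (T - T0) x)\<bar> < d"
  shows "\<exists>T\<in>B. \<forall>x\<in>M. norm (blinfun_apply (T - T0) x) < e"
proof (rule ccontr)
  assume far: "\<not> ?thesis"
  obtain h where "bij_betw h {0..<card M} M"
    using ex_bij_betw_nat_finite[OF M] by blast
  then have h: "M = h ` {..<card M}"
    by (simp add: bij_betw_def lessThan_atLeast0)
  let ?n = "card M"
  define L where "L T = (\<Sum>i<?n. bcontfun_single i (blinfun_apply T (h i)))" for T :: "'a \<Rightarrow>\<^sub>L 'b"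
  have single: "linear (bcontfun_single i)" for i
    by (rule bounded_linear.linear[OF bounded_linear_bcontfun_single])
  have "linear L"
    by (rule linearI)
      (simp_all add: L_def blinfun.bilinear_simps linear_add[OF single] linear_cmul[OF single]
        sum.distrib scaleR_sum_right)
  then have conv: "convex (L ` ((\<lambda>T. T - T0) ` B))"
    by (intro convex_linear_image convex_translation_subtract B)
  have away: "e \<le> norm d" if "d \<in> L ` ((\<lambda>T. T - T0) ` B)" for d
  proof -
    from that obtain T where T: "T \<in> B" "d = L (T - T0)" by auto
    with far obtain x where x: "x \<in> M" "e \<le> norm (blinfun_apply (T - T0) x)"
      by (auto simp: not_less)
    from x(1) have "x \<in> h ` {..<?n}" using h by simp
    then obtain i where i: "i < ?n" "h i = x" by blast
    have "apply_bcontfun d i = blinfun_apply (T - T0) x"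
      using i by (simp add: T(2) L_def apply_bcontfun_sum apply_bcontfun_single)
    then show ?thesis using x(2) norm_bounded[of d i] by simp
  qed
  obtain \<phi> where "norm \<phi> \<le> 1" and \<phi>: "\<forall>d\<in>L ` ((\<lambda>T. T - T0) ` B). e \<le> blinfun_apply \<phi> d"
    using conv away by (rule separate_convex_from_zero)
  define g where "g i = \<phi> o\<^sub>L Blinfun (bcontfun_single i)" for i
  have g: "blinfun_apply (g i) y = blinfun_apply \<phi> (bcontfun_single i y)" for i y
    by (simp add: g_def bounded_linear_Blinfun_apply bounded_linear_bcontfun_single)
  \<comment> \<open>The summand \<open>1\<close> makes \<open>n d < e\<close> strict, also when \<open>M\<close> is empty.\<close>
  define d where "d = e / (real ?n + 1)"
  have "0 < d" using e by (simp add: d_def)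
  then obtain T where T: "T \<in> B"
    and small: "\<forall>\<phi>\<in>g ` {..<?n}. \<forall>x\<in>M. \<bar>blinfun_apply \<phi> (blinfun_apply (T - T0) x)\<bar> < d"
    using weak[OF finite_imageI[OF finite_lessThan]] by blast
  have "e \<le> blinfun_apply \<phi> (L (T - T0))" using T \<phi> by blast
  also have "\<dots> = (\<Sum>i<?n. blinfun_apply (g i) (blinfun_apply (T - T0) (h i)))"
    by (simp add: L_def blinfun.sum_right g)
  also have "\<dots> \<le> (\<Sum>i<?n. d)"
  proof (rule sum_mono)
    fix i assume "i \<in> {..<?n}"
    moreover from this have "h i \<in> M" using h by blast
    ultimately have "\<bar>blinfun_apply (g i) (blinfun_apply (T - T0) (h i))\<bar> < d"
      using small by blast
    then show "blinfun_apply (g i) (blinfun_apply (T - T0) (h i)) \<le> d" by simp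
  qed
  also have "\<dots> = real ?n * d" by simp
  also have "\<dots> < (real ?n + 1) * d" using \<open>0 < d\<close> by simp
  also have "\<dots> = e" by (simp add: d_def)
  finally show False by simp
qed


section \<open>The weak-star topology on operators\<close>

lemma open_fun_contains_finite_ball:
  fixes V :: "('i \<Rightarrow> 'b::metric_space) set"
  assumes "open V" "f \<in> V"
  obtains I e where "finite I" "0 < e" "\<And>g. (\<forall>i\<in>I. dist (g i) (f i) < e) \<Longrightarrow> g \<in> V"
proof -
  have "openin (product_topology (\<lambda>i. euclidean) UNIV) V"
    using assms(1) by (simp add: open_fun_def)
  from product_topology_open_contains_basis[OF this assms(2)]
  obtain X where f: "f \<in> Pi\<^sub>E UNIV X" and X: "\<And>i. open (X i)"
    and fin: "finite {i. X i \<noteq> UNIV}" and sub: "Pi\<^sub>E UNIV X \<subseteq> V"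
    by auto
  let ?I = "{i. X i \<noteq> UNIV}"
  have "\<exists>e>0. ball (f i) e \<subseteq> X i" for i
    using X[of i] f open_contains_ball by (metis PiE_E UNIV_I)
  then obtain r where r: "\<And>i. 0 < r i" "\<And>i. ball (f i) (r i) \<subseteq> X i" by metis
  define e where "e = Min (insert 1 (r ` ?I))"
  have e: "0 < e" "\<And>i. i \<in> ?I \<Longrightarrow> e \<le> r i"
    using fin r(1) by (auto simp: e_def)
  show ?thesis
  proof (rule that[OF fin e(1)])
    fix g assume g: "\<forall>i\<in>?I. dist (g i) (f i) < e"
    have "g i \<in> X i" for i
    proof (cases "i \<in> ?I")
      case True
      with g e(2) have "g i \<in> ball (f i) (r i)" by (force simp: dist_commute)
      then show ?thesis using r(2) by blast
    qed auto
    with sub show "g \<in> V" by (auto simp: PiE_iff)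
  qed
qed

lemma lip0_weak_star_closure_iff:
  fixes T0 :: "('a::real_normed_vector, real) lip0 \<Rightarrow>\<^sub>L ('a, real) lip0"
  shows "T0 \<in> lip0_weak_star closure_of S \<longleftrightarrow>
    (\<forall>U e. finite U \<longrightarrow> 0 < e \<longrightarrow> (\<exists>T\<in>S. \<forall>u\<in>U.
      \<bar>blinfun_apply (projective_dual (lip_to_dual o\<^sub>L T)) u
        - blinfun_apply (projective_dual (lip_to_dual o\<^sub>L T0)) u\<bar> < e))"
proof -
  define P :: "(('a, real) lip0 \<Rightarrow>\<^sub>L ('a, real) lip0) \<Rightarrow> _" where
    "P = (\<lambda>T. projective_dual (lip_to_dual o\<^sub>L T))"
  have openin_iff: "openin lip0_weak_star W \<longleftrightarrow> (\<exists>V. openin strong_operator_topology V \<and> W = P -` V)"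
    for W
    by (simp add: lip0_weak_star_def openin_pullback_topology P_def)
  have open_sot: "openin strong_operator_topology V \<longleftrightarrow> (\<exists>O'. open O' \<and> V = blinfun_apply -` O')"
    for V :: "((('a, real) lip0, 'a free) projective_tensor \<Rightarrow>\<^sub>L real) set"
    by (simp add: strong_operator_topology_def openin_pullback_topology)
  have top: "T0 \<in> topspace lip0_weak_star"
    by (simp add: lip0_weak_star_def topspace_pullback_topology strong_operator_topology_topspace)
  have "T0 \<in> lip0_weak_star closure_of S \<longleftrightarrow> (\<forall>U e. finite U \<longrightarrow> 0 < e \<longrightarrow>
      (\<exists>T\<in>S. \<forall>u\<in>U. \<bar>blinfun_apply (P T) u - blinfun_apply (P T0) u\<bar> < e))"
  proof (intro iffI allI impI)
    fix U :: "(('a, real) lip0, 'a free) projective_tensor set" and e :: real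
    assume cl: "T0 \<in> lip0_weak_star closure_of S" and U: "finite U" and e: "0 < e"
    let ?V = "{\<phi>. \<forall>u\<in>U. blinfun_apply \<phi> u \<in> ball (blinfun_apply (P T0) u) e}"
    have "openin strong_operator_topology ?V"
      by (rule strong_operator_topology_basis[OF U]) simp
    then have "openin lip0_weak_star (P -` ?V)"
      unfolding openin_iff by blast
    moreover have "T0 \<in> P -` ?V" using e by simp
    ultimately obtain T where "T \<in> S" "T \<in> P -` ?V"
      using cl unfolding in_closure_of by meson
    then show "\<exists>T\<in>S. \<forall>u\<in>U. \<bar>blinfun_apply (P T) u - blinfun_apply (P T0) u\<bar> < e"
      by (intro bexI[of _ T]) (auto simp: dist_real_def abs_minus_commute)
  next
    assume approx: "\<forall>U e. finite U \<longrightarrow> 0 < e \<longrightarrow>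
      (\<exists>T\<in>S. \<forall>u\<in>U. \<bar>blinfun_apply (P T) u - blinfun_apply (P T0) u\<bar> < e)"
    have "\<exists>T. T \<in> S \<and> T \<in> W" if W: "T0 \<in> W" "openin lip0_weak_star W" for W
    proof -
      from W(2) obtain O' where O': "open O'" "W = {T. blinfun_apply (P T) \<in> O'}"
        unfolding openin_iff open_sot by auto
      with W(1) have "blinfun_apply (P T0) \<in> O'" by simp
      from open_fun_contains_finite_ball[OF O'(1) this] obtain U e where U: "finite U" "0 < e"
        and ball: "\<And>g. (\<forall>u\<in>U. dist (g u) (blinfun_apply (P T0) u) < e) \<Longrightarrow> g \<in> O'"
        by blast
      obtain T where "T \<in> S" "\<forall>u\<in>U. \<bar>blinfun_apply (P T) u - blinfun_apply (P T0) u\<bar> < e"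
        using approx[rule_format, OF U] by (elim bexE)
      with O'(2) show ?thesis
        by (intro exI[of _ T]) (auto intro!: ball simp: dist_real_def)
    qed
    with top show "T0 \<in> lip0_weak_star closure_of S"
      by (simp add: in_closure_of)
  qed
  then show ?thesis by (simp add: P_def)
qed

lift_definition completion_embed :: "'a::real_normed_vector \<Rightarrow> 'a completion" is bidual_embed
  by (rule subsetD[OF closure_subset]) simp

lemma completion_embed_dense:
  assumes "0 < e"
  obtains v where "norm (u - completion_embed v) < e"
proof -
  obtain v where "dist (bidual_embed v) (Rep_completion u) < e"
    using Rep_completion[of u] assms unfolding closure_approachable by blast
  then have "norm (u - completion_embed v) < e"
    by (simp add: norm_completion.rep_eq minus_completion.rep_eq completion_embed.rep_eq dist_norm
        norm_minus_commute)
  then show ?thesis by (rule that)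
qed

lemma projective_dual_tensor_sum:
  "blinfun_apply (projective_dual S) (completion_embed (tensor_sum zs))
    = (\<Sum>(x, y)\<leftarrow>zs. blinfun_apply (blinfun_apply S x) y)"
proof -
  have "blinfun_apply (tensor_functional S) (tensor_sum zs)
      = (\<Sum>(x, y)\<leftarrow>zs. blinfun_apply (blinfun_apply S x) y)"
    by (induction zs)
      (auto simp: tensor_sum_def blinfun.bilinear_simps tensor_functional_elementary)
  then show ?thesis
    by (simp add: projective_dual_def extend_to_completion.rep_eq completion_embed.rep_eq
        bidual_embed.rep_eq)
qed

lemma projective_dual_diff: "projective_dual (S - T) = projective_dual S - projective_dual T"
proof -
  have "tensor_functional (S - T) = tensor_functional S - tensor_functional T"
    by (rule blinfun_eqI) (simp add: tensor_functional.rep_eq blinfun.bilinear_simps)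
  then show ?thesis
    by (intro blinfun_eqI)
      (simp add: projective_dual_def extend_to_completion.rep_eq blinfun.bilinear_simps)
qed

lemma norm_projective_dual: "norm (projective_dual S) \<le> norm S"
proof (rule norm_blinfun_bound)
  have 1: "norm (tensor_functional S) \<le> norm S"
    by (rule norm_blinfun_bound)
      (auto simp: tensor_functional.rep_eq Rep_tensor_le_norm mult.commute)
  fix u :: "('a, 'b) projective_tensor"
  have "norm (blinfun_apply (projective_dual S) u) \<le> norm u * norm (tensor_functional S)"
    unfolding projective_dual_def extend_to_completion.rep_eq norm_completion.rep_eq
    by (rule norm_blinfun)
  also have "\<dots> \<le> norm u * norm S"
    by (intro mult_left_mono 1 norm_ge_zero)
  finally show "norm (blinfun_apply (projective_dual S) u) \<le> norm S * norm u"
    by (simp add: mult.commute)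
qed simp

text \<open>On bounded sets of operators, the weak-star topology is determined by the elementary tensors: \<open>u\<close> is
  within a small distance \<open>r\<close> of a finite sum of them, and the error in the pairing is at most \<open>c r\<close>.\<close>
lemma bounded_projective_dual_small:
  fixes u :: "('a::real_normed_vector, 'b::real_normed_vector) projective_tensor"
  assumes c: "0 \<le> c" and e: "0 < e"
  obtains P d where "finite P" "0 < d"
    "\<And>S. norm S \<le> c \<Longrightarrow> (\<forall>(x, y)\<in>P. \<bar>blinfun_apply (blinfun_apply S x) y\<bar> \<le> d) \<Longrightarrow>
      \<bar>blinfun_apply (projective_dual S) u\<bar> < e"
proof -
  define r where "r = inverse (c + 1) * (e / 2)"
  have r: "0 < r" using c e by (simp add: r_def)
  have "c * r \<le> (c + 1) * r" using r by simp
  also have "\<dots> = e / 2" using c by (simp add: r_def)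
  finally have cr: "c * r \<le> e / 2" .
  obtain v where v: "norm (u - completion_embed v) < r"
    using completion_embed_dense[OF r] by blast
  obtain zs where zs: "v = tensor_sum zs"
    using tensor_representation by blast
  define d where "d = inverse (real (length zs) + 1) * (e / 2)"
  have d: "0 < d" using e by (simp add: d_def)
  have "real (length zs) * d < (real (length zs) + 1) * d" using d by simp
  also have "\<dots> = e / 2" by (simp add: d_def)
  finally have len: "real (length zs) * d < e / 2" .
  show ?thesis
  proof (rule that[OF finite_set d])
    fix S :: "'a \<Rightarrow>\<^sub>L 'b \<Rightarrow>\<^sub>L real"
    assume S: "norm S \<le> c" and small: "\<forall>(x, y)\<in>set zs. \<bar>blinfun_apply (blinfun_apply S x) y\<bar> \<le> d"
    have "\<bar>\<Sum>(x, y)\<leftarrow>zs. blinfun_apply (blinfun_apply S x) y\<bar> \<le> real (length zs) * d"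
      using small by (induction zs) (auto simp: distrib_right)
    then have main: "\<bar>blinfun_apply (projective_dual S) (completion_embed v)\<bar> < e / 2"
      using len by (simp add: zs projective_dual_tensor_sum)
    have "\<bar>blinfun_apply (projective_dual S) (u - completion_embed v)\<bar>
        \<le> norm (projective_dual S) * norm (u - completion_embed v)"
      using norm_blinfun[of "projective_dual S" "u - completion_embed v"] by simp
    also have "\<dots> \<le> c * r"
      using v S norm_projective_dual[of S] c by (intro mult_mono) auto
    also note cr
    finally show "\<bar>blinfun_apply (projective_dual S) u\<bar> < e"
      using main unfolding blinfun.diff_right by linarith
  qed
qed

lemma bounded_projective_dual_small_finite:
  fixes U :: "('a::real_normed_vector, 'b::real_normed_vector) projective_tensor set"
  assumes "finite U" and c: "0 \<le> c" and e: "0 < e"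
  shows "\<exists>P d. finite P \<and> 0 < d \<and>
    (\<forall>S. norm S \<le> c \<longrightarrow> (\<forall>(x, y)\<in>P. \<bar>blinfun_apply (blinfun_apply S x) y\<bar> \<le> d) \<longrightarrow>
      (\<forall>u\<in>U. \<bar>blinfun_apply (projective_dual S) u\<bar> < e))"
  using assms(1)
proof (induction rule: finite_induct)
  case empty
  show ?case by (intro exI[of _ "{}"] exI[of _ 1]) simp
next
  case (insert u U)
  from insert.IH obtain P d where P: "finite P" "0 < d"
    and PU: "\<And>S. norm S \<le> c \<Longrightarrow> (\<forall>(x, y)\<in>P. \<bar>blinfun_apply (blinfun_apply S x) y\<bar> \<le> d) \<Longrightarrow>
      (\<forall>u\<in>U. \<bar>blinfun_apply (projective_dual S) u\<bar> < e)" by blast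
  obtain Q r where Q: "finite Q" "0 < r"
    and Qu: "\<And>S. norm S \<le> c \<Longrightarrow> (\<forall>(x, y)\<in>Q. \<bar>blinfun_apply (blinfun_apply S x) y\<bar> \<le> r) \<Longrightarrow>
      \<bar>blinfun_apply (projective_dual S) u\<bar> < e"
    using bounded_projective_dual_small[OF c e, of u] by blast
  have "\<forall>v\<in>insert u U. \<bar>blinfun_apply (projective_dual S) v\<bar> < e"
    if S: "norm S \<le> c"
      and small: "\<forall>(x, y)\<in>P \<union> Q. \<bar>blinfun_apply (blinfun_apply S x) y\<bar> \<le> min d r" for S
    using PU[OF S] Qu[OF S] small by fastforce
  with P Q show ?case
    by (intro exI[of _ "P \<union> Q"] exI[of _ "min d r"]) simp
qed


section \<open>Conjugate operators on \<open>Lip\<^sub>0(X)\<close>\<close>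

lemma norm_free_pairing: "norm (free_pairing g) \<le> norm g"
proof (rule norm_blinfun_bound)
  show "norm (blinfun_apply (free_pairing g) \<mu>) \<le> norm g * norm \<mu>" for \<mu>
    using norm_blinfun[of "Rep_free \<mu>" g]
    by (simp add: free_pairing.rep_eq norm_free.rep_eq mult.commute)
qed (rule norm_lip0_nonneg)

lemma free_pairing_dual_to_lip: "free_pairing (blinfun_apply dual_to_lip \<phi>) = \<phi>"
  using lip_to_dual_to_lip[of \<phi>] by (simp add: lip_to_dual.rep_eq)

lemma conjugate_minus_identity_pairing:
  "blinfun_apply (blinfun_apply ((lip_to_dual o\<^sub>L on_lip0 (adjoint_op T)) - (lip_to_dual o\<^sub>L id_blinfun)) g) \<mu>
    = blinfun_apply (free_pairing g) (blinfun_apply T \<mu> - \<mu>)"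
  by (simp add: on_lip0_def free_pairing_dual_to_lip adjoint_op.rep_eq lip_to_dual.rep_eq
      blinfun.bilinear_simps)

lemma norm_conjugate_minus_identity:
  fixes T :: "'a::real_normed_vector free \<Rightarrow>\<^sub>L 'a free"
  shows "norm ((lip_to_dual o\<^sub>L on_lip0 (adjoint_op T)) - (lip_to_dual o\<^sub>L id_blinfun)) \<le> norm T + 1"
proof (intro norm_blinfun_bound)
  fix g :: "('a, real) lip0" and \<mu> :: "'a free"
  have "norm (blinfun_apply T \<mu> - \<mu>) \<le> norm T * norm \<mu> + norm \<mu>"
    by (intro order_trans[OF norm_triangle_ineq4] add_right_mono norm_blinfun)
  then have "norm (free_pairing g) * norm (blinfun_apply T \<mu> - \<mu>) \<le> norm g * ((norm T + 1) * norm \<mu>)"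
    by (intro mult_mono norm_free_pairing) (simp_all add: distrib_right norm_lip0_nonneg)
  then show "norm (blinfun_apply (blinfun_apply
      ((lip_to_dual o\<^sub>L on_lip0 (adjoint_op T)) - (lip_to_dual o\<^sub>L id_blinfun)) g) \<mu>)
      \<le> (norm T + 1) * norm g * norm \<mu>"
    unfolding conjugate_minus_identity_pairing
    using norm_blinfun[of "free_pairing g" "blinfun_apply T \<mu> - \<mu>"] by (simp add: mult_ac)
qed (simp_all add: norm_lip0_nonneg)

text \<open>On elementary tensors, \<open>\<langle>g \<otimes> \<mu>, T\<^sup>*\<rangle> = g(T \<mu>)\<close>, so for bounded sets of conjugates the weak-star
  topology is the weak operator topology of the operators themselves; convexity turns it into the
  strong one.\<close>
lemma conjugates_weak_star_closure_iff:
  fixes B :: "('a::real_normed_vector free \<Rightarrow>\<^sub>L 'a free) set"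
  assumes B: "convex B" and bound: "\<And>T. T \<in> B \<Longrightarrow> norm T \<le> lam" and lam: "0 \<le> lam"
  shows "id_blinfun \<in> lip0_weak_star closure_of (on_lip0 ` adjoint_op ` B) \<longleftrightarrow>
    (\<forall>M e. finite M \<longrightarrow> 0 < e \<longrightarrow> (\<exists>T\<in>B. \<forall>\<mu>\<in>M. norm (blinfun_apply T \<mu> - \<mu>) < e))"
    (is "?d \<longleftrightarrow> ?s")
proof
  assume d: ?d
  show ?s
  proof (intro allI impI)
    fix M :: "'a free set" and e :: real assume M: "finite M" and e: "0 < e"
    have "\<exists>T\<in>B. \<forall>\<mu>\<in>M. norm (blinfun_apply (T - id_blinfun) \<mu>) < e"
    proof (rule weak_approx_imp_strong_approx[OF B M e])
      fix \<Phi> :: "('a free \<Rightarrow>\<^sub>L real) set" and r :: real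
      assume \<Phi>: "finite \<Phi>" and r: "0 < r"
      let ?u = "\<lambda>(\<phi>, \<mu>). completion_embed (tensor_sum [(blinfun_apply dual_to_lip \<phi>, \<mu>)])"
      have "finite (?u ` (\<Phi> \<times> M))" using \<Phi> M by simp
      from d[unfolded lip0_weak_star_closure_iff, rule_format, OF this r]
      obtain T where T: "T \<in> B"
        and small: "\<forall>u\<in>?u ` (\<Phi> \<times> M).
          \<bar>blinfun_apply (projective_dual (lip_to_dual o\<^sub>L on_lip0 (adjoint_op T))) u
            - blinfun_apply (projective_dual (lip_to_dual o\<^sub>L id_blinfun)) u\<bar> < r"
        unfolding bex_simps by blast
      have "\<bar>blinfun_apply \<phi> (blinfun_apply (T - id_blinfun) \<mu>)\<bar> < r" if "\<phi> \<in> \<Phi>" "\<mu> \<in> M" for \<phi> \<mu>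
      proof -
        have "?u (\<phi>, \<mu>) \<in> ?u ` (\<Phi> \<times> M)" using that by blast
        from bspec[OF small this]
        have "\<bar>blinfun_apply (projective_dual
            ((lip_to_dual o\<^sub>L on_lip0 (adjoint_op T)) - (lip_to_dual o\<^sub>L id_blinfun))) (?u (\<phi>, \<mu>))\<bar> < r"
          by (simp only: projective_dual_diff blinfun.diff_left)
        then show ?thesis
          by (simp only: projective_dual_tensor_sum list.map sum_list.Cons sum_list.Nil case_prod_conv
              conjugate_minus_identity_pairing free_pairing_dual_to_lip)
            (simp add: blinfun.bilinear_simps)
      qed
      with T show "\<exists>T\<in>B. \<forall>\<phi>\<in>\<Phi>. \<forall>\<mu>\<in>M. \<bar>blinfun_apply \<phi> (blinfun_apply (T - id_blinfun) \<mu>)\<bar> < r"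
        by blast
    qed
    then show "\<exists>T\<in>B. \<forall>\<mu>\<in>M. norm (blinfun_apply T \<mu> - \<mu>) < e"
      by (simp add: blinfun.bilinear_simps)
  qed
next
  assume s: ?s
  show ?d
    unfolding lip0_weak_star_closure_iff
  proof (intro allI impI)
    fix U :: "(('a, real) lip0, 'a free) projective_tensor set" and e :: real
    assume U: "finite U" and e: "0 < e"
    have "0 \<le> lam + 1" using lam by simp
    from bounded_projective_dual_small_finite[OF U this e]
    obtain P r where P: "finite P" "0 < r"
      and small: "\<And>S. norm S \<le> lam + 1 \<Longrightarrow> (\<forall>(g, \<mu>)\<in>P. \<bar>blinfun_apply (blinfun_apply S g) \<mu>\<bar> \<le> r) \<Longrightarrow>
        (\<forall>u\<in>U. \<bar>blinfun_apply (projective_dual S) u\<bar> < e)"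
      by blast
    define c where "c = (\<Sum>p\<in>P. norm (fst p))"
    have c: "0 \<le> c" unfolding c_def by (rule sum_nonneg) (rule norm_lip0_nonneg)
    \<comment> \<open>Since \<open>\<parallel>g\<parallel> \<le> c\<close> for all \<open>(g, \<mu>) \<in> P\<close>, moving each \<open>\<mu>\<close> by less than \<open>t\<close> makes each
      \<open>g(T \<mu> - \<mu>)\<close> at most \<open>r\<close>.\<close>
    define t where "t = inverse (c + 1) * r"
    have t: "0 < t" using c P(2) by (simp add: t_def)
    have "c * t \<le> (c + 1) * t" using t by simp
    also have "\<dots> = r" using c by (simp add: t_def)
    finally have ct: "c * t \<le> r" .
    obtain T where T: "T \<in> B" "\<forall>\<mu>\<in>snd ` P. norm (blinfun_apply T \<mu> - \<mu>) < t"
      using s[rule_format, OF finite_imageI[OF P(1), of snd] t] by (elim bexE)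
    let ?D = "(lip_to_dual o\<^sub>L on_lip0 (adjoint_op T)) - (lip_to_dual o\<^sub>L id_blinfun)"
    have "\<forall>u\<in>U. \<bar>blinfun_apply (projective_dual ?D) u\<bar> < e"
    proof (rule small)
      show "norm ?D \<le> lam + 1"
        using norm_conjugate_minus_identity[of T] bound[OF T(1)] by simp
      have "\<bar>blinfun_apply (blinfun_apply ?D g) \<mu>\<bar> \<le> r" if "(g, \<mu>) \<in> P" for g \<mu>
      proof -
        have "norm g \<le> c"
          unfolding c_def
          using member_le_sum[OF that _ P(1), of "\<lambda>p. norm (fst p)"] by (simp add: norm_lip0_nonneg)
        moreover have "norm (blinfun_apply T \<mu> - \<mu>) \<le> t"
          using T(2) that by force
        moreover have "\<bar>blinfun_apply (blinfun_apply ?D g) \<mu>\<bar>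
            \<le> norm (free_pairing g) * norm (blinfun_apply T \<mu> - \<mu>)"
          unfolding conjugate_minus_identity_pairing
          using norm_blinfun[of "free_pairing g" "blinfun_apply T \<mu> - \<mu>"] by simp
        ultimately show ?thesis
          using mult_mono[of "norm (free_pairing g)" c "norm (blinfun_apply T \<mu> - \<mu>)" t]
            norm_free_pairing[of g] c ct by simp
      qed
      then show "\<forall>(g, \<mu>)\<in>P. \<bar>blinfun_apply (blinfun_apply ?D g) \<mu>\<bar> \<le> r" by blast
    qed
    with T(1) show "\<exists>T\<in>on_lip0 ` adjoint_op ` B. \<forall>u\<in>U.
        \<bar>blinfun_apply (projective_dual (lip_to_dual o\<^sub>L T)) u
          - blinfun_apply (projective_dual (lip_to_dual o\<^sub>L id_blinfun)) u\<bar> < e"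
      by (auto simp only: projective_dual_diff blinfun.diff_left intro!: bexI[of _ "on_lip0 (adjoint_op T)"])
  qed
qed


section \<open>The approximation properties\<close>

lemma has_BAP_iff_finite:
  assumes lam: "0 \<le> lam"
  shows "has_BAP A lam TYPE('z::banach) \<longleftrightarrow>
    (\<forall>(M :: 'z set) e. finite M \<longrightarrow> 0 < e \<longrightarrow>
      (\<exists>T\<in>ideal_ball A lam. \<forall>x\<in>M. norm (blinfun_apply T x - x) < e))"
proof -
  have "has_BAP A lam TYPE('z) \<longleftrightarrow>
    (\<forall>(K :: 'z set) e. compact K \<longrightarrow> 0 < e \<longrightarrow>
      (\<exists>T\<in>ideal_ball A lam. \<forall>x\<in>K. norm (blinfun_apply T x - x) < e))"
    by (simp add: has_BAP_def compact_convergence_closure_iff dist_norm)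
  also have "\<dots> \<longleftrightarrow> (\<forall>(M :: 'z set) e. finite M \<longrightarrow> 0 < e \<longrightarrow>
      (\<exists>T\<in>ideal_ball A lam. \<forall>x\<in>M. norm (blinfun_apply T x - x) < e))" (is "?c \<longleftrightarrow> ?f")
  proof
    assume ?c
    then show ?f by (simp add: finite_imp_compact)
  next
    assume f: ?f
    show ?c
    proof (intro allI impI)
      fix K :: "'z set" and e :: real assume K: "compact K" and e: "0 < e"
      show "\<exists>T\<in>ideal_ball A lam. \<forall>x\<in>K. norm (blinfun_apply T x - x) < e"
        by (rule identity_approx_on_compact[OF _ lam _ _ K e, where M = UNIV])
          (use f in \<open>auto simp: ideal_ball_def\<close>)
    qed
  qed
  finally show ?thesis .
qed

text \<open>Both sides say that the identity is a limit of the ideal ball in the strong operator topology.\<close>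
lemma has_BAP_iff_conjugates:
  assumes A: "operator_ideal A" and lam: "0 \<le> lam"
  shows "has_BAP A lam TYPE('a::real_normed_vector free) \<longleftrightarrow>
    (id_blinfun :: ('a, real) lip0 \<Rightarrow>\<^sub>L ('a, real) lip0) \<in>
      lip0_weak_star closure_of (on_lip0 ` conjugate_ball A lam)"
proof -
  have "(id_blinfun :: ('a, real) lip0 \<Rightarrow>\<^sub>L ('a, real) lip0) \<in>
      lip0_weak_star closure_of (on_lip0 ` conjugate_ball A lam) \<longleftrightarrow>
    (\<forall>(M :: 'a free set) e. finite M \<longrightarrow> 0 < e \<longrightarrow>
      (\<exists>T\<in>ideal_ball A lam. \<forall>x\<in>M. norm (blinfun_apply T x - x) < e))"
    unfolding conjugate_ball_def
    by (rule conjugates_weak_star_closure_iff[OF convex_ideal_ball[OF A] _ lam])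
      (simp add: ideal_ball_def)
  then show ?thesis by (simp add: has_BAP_iff_finite[OF lam])
qed

text \<open>An operator \<open>T\<close> in the ideal is a Lipschitz map whose linearization \<open>T \<circ> \<beta>\<close> is again in the
  ideal.\<close>
lemma has_BAP_imp_has_lip_BAP:
  fixes A :: "'u bspace \<Rightarrow> 'u bspace \<Rightarrow> ('u \<Rightarrow> 'u) set"
    and i :: "'z::banach free \<Rightarrow> 'u" and j :: "'z \<Rightarrow> 'u"
  assumes A: "operator_ideal A" and i: "inj i" and j: "inj j" and BAP: "has_BAP A lam TYPE('z)"
  shows "has_lip_BAP A lam TYPE('z)"
  unfolding has_lip_BAP_def compact_convergence_closure_iff
proof (intro allI impI)
  fix K :: "'z set" and e :: real assume K: "compact K" and e: "0 < e"
  obtain T :: "'z \<Rightarrow>\<^sub>L 'z" where T: "T \<in> ideal_ball A lam" "\<forall>x\<in>K. dist (blinfun_apply T x) (id x) < e"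
    using BAP K e unfolding has_BAP_def compact_convergence_closure_iff by blast
  have "id_blinfun o\<^sub>L T o\<^sub>L barycenter \<in> ideal_component A"
    by (rule ideal_component_compose[OF A i j]) (use T in \<open>simp add: ideal_ball_def\<close>)
  moreover have "id_blinfun o\<^sub>L T o\<^sub>L barycenter = linearization (lip0_of_blinfun T)"
    unfolding linearization_of_blinfun by (rule blinfun_eqI) simp
  ultimately have "lip0_of_blinfun T \<in> lip_ideal_ball A lam"
    using T(1) norm_lip0_of_blinfun[of T]
    by (auto simp: lip_ideal_ball_def lip_ideal_def ideal_ball_def)
  with T(2) show "\<exists>g\<in>lip_apply ` lip_ideal_ball A lam. \<forall>x\<in>K. dist (g x) (id x) < e"
    by (intro bexI[OF _ imageI[of "lip0_of_blinfun T"]]) (simp_all add: lip0_of_blinfun.rep_eq)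
qed

text \<open>Compose with \<open>\<delta>\<close>: if \<open>f\<close> is close to the identity of the free space on the compact set
  \<open>\<delta>(K)\<close>, then \<open>f \<circ> \<delta>\<close> is close to \<open>\<delta>\<close> on \<open>K\<close>.\<close>
lemma has_lip_BAP_free_imp_delta_approx:
  fixes A :: "'u bspace \<Rightarrow> 'u bspace \<Rightarrow> ('u \<Rightarrow> 'u) set" and i :: "'a::banach free \<Rightarrow> 'u"
  assumes A: "operator_ideal A" and i: "inj i" and BAP: "has_lip_BAP A lam TYPE('a free)"
  shows "(delta :: 'a \<Rightarrow> 'a free) \<in> compact_convergence closure_of (lip_apply ` lip_ideal_ball A lam)"
  unfolding compact_convergence_closure_iff
proof (intro allI impI)
  fix K :: "'a set" and e :: real assume K: "compact K" and e: "0 < e"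
  have "continuous_on UNIV (delta :: 'a \<Rightarrow> _)"
    by (rule lipschitz_on_continuous_on[of 1], rule lipschitz_onI)
      (simp_all add: dist_norm norm_delta_diff_le)
  then have "compact (delta ` K)"
    using K by (intro compact_continuous_image) (auto intro: continuous_on_subset)
  with BAP e obtain f :: "('a free, 'a free) lip0" where f: "f \<in> lip_ideal_ball A lam"
    and close: "\<forall>\<mu>\<in>delta ` K. dist (lip_apply f \<mu>) (id \<mu>) < e"
    unfolding has_lip_BAP_def compact_convergence_closure_iff by blast
  have "id_blinfun o\<^sub>L linearization f o\<^sub>L linearization (comp_lip0 delta_lip0 delta_lip0) \<in> ideal_component A"
    by (rule ideal_component_compose[OF A i i])
      (use f in \<open>simp add: lip_ideal_ball_def lip_ideal_def\<close>)
  moreover have "id_blinfun o\<^sub>L linearization f o\<^sub>L linearization (comp_lip0 delta_lip0 delta_lip0)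
      = linearization (comp_lip0 f delta_lip0)"
    unfolding linearization_comp[of f] by (rule blinfun_eqI) simp
  moreover have "norm (comp_lip0 f delta_lip0 :: ('a, 'a free) lip0) \<le> lam"
  proof -
    have "norm (comp_lip0 f delta_lip0 :: ('a, 'a free) lip0) \<le> norm f * norm (delta_lip0 :: ('a, 'a free) lip0)"
      by (rule norm_comp_lip0)
    also have "\<dots> \<le> norm f" by (intro mult_left_le norm_delta_lip0 norm_lip0_nonneg)
    finally show ?thesis using f by (simp add: lip_ideal_ball_def)
  qed
  ultimately have "comp_lip0 f delta_lip0 \<in> (lip_ideal_ball A lam :: ('a, 'a free) lip0 set)"
    by (simp add: lip_ideal_ball_def lip_ideal_def)
  with close show "\<exists>g\<in>lip_apply ` lip_ideal_ball A lam. \<forall>x\<in>K. dist (g x) (delta x :: 'a free) < e"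
    by (intro bexI[OF _ imageI[of "comp_lip0 f delta_lip0"]])
      (simp_all add: comp_lip0.rep_eq delta_lip0.rep_eq)
qed

text \<open>Linearize: \<open>L\<^sub>f\<close> agrees with \<open>f\<close> along \<open>\<delta>\<close>, so \<open>L\<^sub>f\<close> is close to the identity on finitely many
  points \<open>\<delta>\<^sub>x\<close>, which span a dense subspace.\<close>
lemma delta_approx_imp_has_BAP_free:
  fixes A :: "'u bspace \<Rightarrow> 'u bspace \<Rightarrow> ('u \<Rightarrow> 'u) set"
  assumes lam: "0 \<le> lam" and approx: "(delta :: 'a::banach \<Rightarrow> 'a free) \<in>
    compact_convergence closure_of (lip_apply ` lip_ideal_ball A lam)"
  shows "has_BAP A lam TYPE('a free)"
  unfolding has_BAP_def compact_convergence_closure_iff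
proof (intro allI impI)
  fix K :: "'a free set" and e :: real assume K: "compact K" and e: "0 < e"
  have "\<exists>T\<in>ideal_ball A lam. \<forall>\<mu>\<in>K. norm (blinfun_apply T \<mu> - \<mu>) < e"
  proof (rule identity_approx_on_compact[OF _ lam closure_span_delta _ K e])
    fix F :: "'a free set" and d :: real
    assume F: "finite F" "F \<subseteq> range delta" and d: "0 < d"
    from finite_subset_image[OF F] obtain M where M: "finite M" "F = delta ` M" by blast
    obtain f where f: "f \<in> lip_ideal_ball A lam" "\<forall>x\<in>M. dist (lip_apply f x) (delta x) < d"
      using approx[unfolded compact_convergence_closure_iff] finite_imp_compact[OF M(1)] d by blast
    have "linearization f \<in> ideal_ball A lam"
      using f(1) norm_linearization_le[of f]
      by (auto simp: lip_ideal_ball_def lip_ideal_def ideal_ball_def)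
    moreover have "\<forall>\<mu>\<in>F. norm (blinfun_apply (linearization f) \<mu> - \<mu>) < d"
      using f(2) by (simp add: M(2) linearization_delta dist_norm)
    ultimately show "\<exists>T\<in>ideal_ball A lam. \<forall>\<mu>\<in>F. norm (blinfun_apply T \<mu> - \<mu>) < d" ..
  qed (simp add: ideal_ball_def)
  then show "\<exists>g\<in>blinfun_apply ` ideal_ball A lam. \<forall>\<mu>\<in>K. dist (g \<mu>) (id \<mu>) < e"
    by (simp add: dist_norm)
qed

text \<open>Compose with the barycenter map: if \<open>f\<close> is close to \<open>\<delta>\<close> on \<open>K\<close>, then \<open>\<beta> \<circ> f\<close> is close to
  \<open>\<beta> \<circ> \<delta> = id\<close> on \<open>K\<close>.\<close>
lemma delta_approx_imp_has_lip_BAP: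
  fixes A :: "'u bspace \<Rightarrow> 'u bspace \<Rightarrow> ('u \<Rightarrow> 'u) set"
    and i :: "'a::banach free \<Rightarrow> 'u" and j :: "'a \<Rightarrow> 'u"
  assumes A: "operator_ideal A" and i: "inj i" and j: "inj j"
    and approx: "(delta :: 'a \<Rightarrow> 'a free) \<in>
      compact_convergence closure_of (lip_apply ` lip_ideal_ball A lam)"
  shows "has_lip_BAP A lam TYPE('a)"
  unfolding has_lip_BAP_def compact_convergence_closure_iff
proof (intro allI impI)
  fix K :: "'a set" and e :: real assume K: "compact K" and e: "0 < e"
  obtain f where f: "f \<in> lip_ideal_ball A lam" "\<forall>x\<in>K. dist (lip_apply f x) (delta x) < e"
    using approx[unfolded compact_convergence_closure_iff] K e by blast
  let ?g = "blinfun_comp_lip0 barycenter f"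
  have "barycenter o\<^sub>L linearization f o\<^sub>L id_blinfun \<in> ideal_component A"
    by (rule ideal_component_compose[OF A i j])
      (use f in \<open>simp add: lip_ideal_ball_def lip_ideal_def\<close>)
  moreover have "barycenter o\<^sub>L linearization f o\<^sub>L id_blinfun = linearization ?g"
    unfolding linearization_blinfun_comp by (rule blinfun_eqI) simp
  moreover have "norm ?g \<le> lam"
  proof -
    have "norm ?g \<le> norm (barycenter :: 'a free \<Rightarrow>\<^sub>L 'a) * norm f" by (rule norm_blinfun_comp_lip0)
    also have "\<dots> \<le> norm f" by (rule mult_left_le_one_le) (simp_all add: norm_lip0_nonneg norm_barycenter)
    finally show ?thesis using f by (simp add: lip_ideal_ball_def)
  qed
  ultimately have "?g \<in> lip_ideal_ball A lam"
    by (simp add: lip_ideal_ball_def lip_ideal_def)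
  moreover have "dist (lip_apply ?g x) (id x) < e" if "x \<in> K" for x
  proof -
    have "dist (lip_apply ?g x) (id x) = norm (blinfun_apply barycenter (lip_apply f x - delta x))"
      by (simp add: comp_lip0.rep_eq lip0_of_blinfun.rep_eq dist_norm blinfun.diff_right barycenter_delta)
    also have "\<dots> \<le> norm (barycenter :: 'a free \<Rightarrow>\<^sub>L 'a) * norm (lip_apply f x - delta x)"
      by (rule norm_blinfun)
    also have "\<dots> \<le> norm (lip_apply f x - delta x)"
      by (rule mult_left_le_one_le) (simp_all add: norm_barycenter)
    also have "\<dots> < e" using f(2) that by (simp add: dist_norm)
    finally show ?thesis .
  qed
  ultimately show "\<exists>g\<in>lip_apply ` lip_ideal_ball A lam. \<forall>x\<in>K. dist (g x) (id x) < e" by blast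
qed

theorem theorem3p2:
  fixes A :: "'u bspace \<Rightarrow> 'u bspace \<Rightarrow> ('u \<Rightarrow> 'u) set" and lam :: real
  assumes universe: "\<exists>\<iota> :: 'a::banach free free \<Rightarrow> 'u. inj \<iota>"
    and ideal: "operator_ideal A"
    and lam: "lam \<ge> 1"
  shows "let
      a = has_lip_BAP A lam TYPE('a free);
      b = has_BAP A lam TYPE('a free);
      c = (delta :: 'a \<Rightarrow> 'a free) \<in>
        compact_convergence closure_of (lip_apply ` lip_ideal_ball A lam);
      d = (id_blinfun :: ('a, real) lip0 \<Rightarrow>\<^sub>L ('a, real) lip0) \<in>
        lip0_weak_star closure_of (on_lip0 ` conjugate_ball A lam)
    in (a \<longleftrightarrow> b) \<and> (b \<longleftrightarrow> c) \<and> (c \<longleftrightarrow> d) \<and>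
       (a \<or> b \<or> c \<or> d \<longrightarrow> has_lip_BAP A lam TYPE('a))"
proof -
  obtain i2 :: "'a free free \<Rightarrow> 'u" where i2: "inj i2" using universe by blast
  have inj_delta: "inj (delta :: 'z::banach \<Rightarrow> 'z free)"
    by (rule inj_on_inverseI) (rule barycenter_delta)
  have i1: "inj (\<lambda>\<mu> :: 'a free. i2 (delta \<mu>))"
    using inj_compose[OF i2 inj_delta] by (simp add: comp_def)
  have i0: "inj (\<lambda>x :: 'a. i2 (delta (delta x)))"
    using inj_compose[OF i1 inj_delta] by (simp add: comp_def)
  have lam0: "0 \<le> lam" using lam by simp
  \<comment> \<open>The step from (b) to (c) passes through (a).\<close>
  note implications =
    has_BAP_imp_has_lip_BAP[OF ideal i2 i1, of lam]
    has_lip_BAP_free_imp_delta_approx[OF ideal i1, of lam]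
    delta_approx_imp_has_BAP_free[OF lam0, of A, where 'a = 'a]
    has_BAP_iff_conjugates[OF ideal lam0, where 'a = 'a]
    delta_approx_imp_has_lip_BAP[OF ideal i1 i0, of lam]
  show ?thesis
    unfolding Let_def using implications by argo
qed

end
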